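(* Let $n\ge 2$, $i\in[0,n]$, $\lambda\in \mathrm{P}_c^{2n}$ and $\kappa:=\mathfrak{p}^{-1}(\lambda)\in\mathcal{C}_{2n}^c$. Then $$s_i\cdot\kappa=\begin{cases}\mathfrak{p}^{-1}(\lambda+\epsilon_a), & \text{if } \mathrm{dg}(\kappa)\subsetneq\mathrm{dg}(s_i\cdot\kappa),\\ \mathfrak{p}^{-1}(\lambda-\epsilon_r), & \text{if } \mathrm{dg}(\kappa)\supsetneq\mathrm{dg}(s_i\cdot\kappa),\\ \kappa, & \text{otherwise},\end{cases}$$ where $$a:=\max\{c \mid (c,d)\text{ is an addable corner of }\kappa\text{ with residue } i \text{ or } 2n-i \text{ mod } 2n,\text{ and } d-c\ge0\},$$ $$r:=\max\{c \mid (c,d)\text{ is a removable corner of }\kappa\text{ with residue } i \text{ or } 2n-i \text{ mod } 2n,\text{ and } d-c\ge0\}.$$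
   Context: **Partitions and cores.** A partition $\lambda=(\lambda_1,\dots,\lambda_{\ell(\lambda)})$ is a weakly decreasing sequence of positive integers, with $\lambda_i=0$ for $i>\ell(\lambda)$. Its Young diagram is $\mathrm{dg}(\lambda)=\{(r,c)\in\mathbb{Z}_{\ge1}^2: c\le\lambda_r\}$ (French notation: row index $r$ increases from south to north, column index from west to east). The hook length $\mathrm{hl}$ of a box is the number of boxes strictly above it in its column plus the number of boxes weakly to its right in its row. A $2n$-core is a partition with no box of hook length $2n$; $\mathcal{C}_{2n}^c$ is the set of symmetric $2n$-cores ($(i,j)\in\mathrm{dg}(\kappa)$ iff $(j,i)\in\mathrm{dg}(\kappa)$). The content of a box $(i,j)$ is $j-i$ and its residue is its content modulo $2n$. An addable (removable) corner of $\lambda$ is a box outside (inside) $\mathrm{dg}(\lambda)$ whose addition (removal) yields the diagram of a partition. **Action.** The affine Weyl group $\widetilde{C}_n$ of type C, generated by $s_0,\dots,s_n$, acts on $\mathcal{C}_{2n}^c$ by: if $\kappa$ has at least one addable corner of residue $i$, then $s_i\cdot\kappa$ is obtained by adding all addable corners of residue $i$ or $2n-i$ modulo $2n$; if $\kappa$ has at least one removable corner of residue $i$, then $s_i\cdot\kappa$ is obtained by removing all removable corners of residue $i$ or $2n-i$ modulo $2n$; otherwise $s_i\cdot\kappa=\kappa$. (It is known that this is a well-defined group action.) **Bounded partitions and the bijection $\mathfrak{p}$.** $\mathrm{P}_c^{2n}$ is the set of partitions $\lambda$ with $\lambda_1\le 2n$ and $\lambda_i>\lambda_{i+1}$ whenever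 $i<\ell(\lambda)$ and $\lambda_i\le n$. There is a (known) bijection $\mathfrak{p}:\mathcal{C}_{2n}^c\to\mathrm{P}_c^{2n}$ given by $\mathfrak{p}(\kappa)=(\lambda_1,\dots,\lambda_\ell)$, where $\ell=\#\{(i,j)\in\mathrm{dg}(\kappa): i=j\}$ and, for $b\in[1,\ell]$, $$\lambda_b=1+\#\{(b,j)\in\mathrm{dg}(\kappa): b<j,\ \mathrm{hl}(b,j)<2n\}.$$ **Notation.** $\epsilon_a$ is the finitely supported sequence with $1$ in position $a$ and $0$ elsewhere; partitions are identified with finitely supported sequences by appending zeros. $[0,n]=\{0,1,\dots,n\}$. The first two cases include the assertion that $\lambda+\epsilon_a$, respectively $\lambda-\epsilon_r$, lies in $\mathrm{P}_c^{2n}$. *)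

theory Defs
  imports Complex_Main
begin

text \<open>
  Partitions are finitely supported sequences indexed by the positive integers. They are
  represented by functions on \<open>nat\<close>; the unused value at index 0 is fixed to 0,
  so that equality of functions is equality of partitions.
\<close>

definition is_partition :: "(nat \<Rightarrow> nat) \<Rightarrow> bool" where
  "is_partition lam \<longleftrightarrow>
     lam 0 = 0 \<and> (\<forall>i\<ge>1. lam (i + 1) \<le> lam i) \<and> finite {i. lam i \<noteq> 0}"

definition plen :: "(nat \<Rightarrow> nat) \<Rightarrow> nat" where
  "plen lam = card {i. lam i \<noteq> 0}"

text \<open>Boxes are pairs (row, column), both counted from 1.\<close>

definition dg :: "(nat \<Rightarrow> nat) \<Rightarrow> (nat \<times> nat) set" where
  "dg lam = {(r, c). 1 \<le> r \<and> 1 \<le> c \<and> c \<le> lam r}"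

definition part_of_dg :: "(nat \<times> nat) set \<Rightarrow> nat \<Rightarrow> nat" where
  "part_of_dg D = (\<lambda>r. card {c. (r, c) \<in> D})"

lemma part_of_dg_dg: "is_partition lam \<Longrightarrow> part_of_dg (dg lam) = lam"
proof
  fix r assume *: "is_partition lam"
  show "part_of_dg (dg lam) r = lam r"
  proof (cases "r = 0")
    case True
    with * show ?thesis by (simp add: part_of_dg_def dg_def is_partition_def)
  next
    case False
    then have "{c. (r, c) \<in> dg lam} = {1..lam r}" by (auto simp: dg_def)
    then show ?thesis by (simp add: part_of_dg_def)
  qed
qed

fun hl :: "(nat \<Rightarrow> nat) \<Rightarrow> nat \<times> nat \<Rightarrow> nat" where
  "hl lam (r, c) = card {r'. r < r' \<and> (r', c) \<in> dg lam} + card {c'. c \<le> c' \<and> (r, c') \<in> dg lam}"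

definition is_core :: "nat \<Rightarrow> (nat \<Rightarrow> nat) \<Rightarrow> bool" where
  "is_core m kap \<longleftrightarrow> is_partition kap \<and> (\<forall>b\<in>dg kap. hl kap b \<noteq> m)"

definition is_symmetric :: "(nat \<Rightarrow> nat) \<Rightarrow> bool" where
  "is_symmetric kap \<longleftrightarrow> (\<forall>i j. (i, j) \<in> dg kap \<longleftrightarrow> (j, i) \<in> dg kap)"

definition sym_cores :: "nat \<Rightarrow> (nat \<Rightarrow> nat) set" where
  "sym_cores n = {kap. is_core (2 * n) kap \<and> is_symmetric kap}"

fun content :: "nat \<times> nat \<Rightarrow> int" where
  "content (r, c) = int c - int r"

definition residue :: "nat \<Rightarrow> nat \<times> nat \<Rightarrow> int" where
  "residue n b = content b mod (2 * int n)"

definition addable :: "(nat \<Rightarrow> nat) \<Rightarrow> nat \<times> nat \<Rightarrow> bool" where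
  "addable lam b \<longleftrightarrow> b \<notin> dg lam \<and> (\<exists>mu. is_partition mu \<and> dg mu = insert b (dg lam))"

definition removable :: "(nat \<Rightarrow> nat) \<Rightarrow> nat \<times> nat \<Rightarrow> bool" where
  "removable lam b \<longleftrightarrow> b \<in> dg lam \<and> (\<exists>mu. is_partition mu \<and> dg mu = dg lam - {b})"

definition residue_pm :: "nat \<Rightarrow> nat \<Rightarrow> nat \<times> nat \<Rightarrow> bool" where
  "residue_pm n i b \<longleftrightarrow>
     residue n b = int i mod (2 * int n) \<or> residue n b = (2 * int n - int i) mod (2 * int n)"

text \<open>
  Action of the generator \<open>s_i\<close> of the affine Weyl group on symmetric \<open>2n\<close>-cores. A core cannot
  have addable and removable corners of the same residue, so the order of the
  cases is immaterial there.
\<close>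

definition s_act :: "nat \<Rightarrow> nat \<Rightarrow> (nat \<Rightarrow> nat) \<Rightarrow> (nat \<Rightarrow> nat)" where
  "s_act n i kap =
     (if \<exists>b. addable kap b \<and> residue n b = int i mod (2 * int n)
      then part_of_dg (dg kap \<union> {b. addable kap b \<and> residue_pm n i b})
      else if \<exists>b. removable kap b \<and> residue n b = int i mod (2 * int n)
      then part_of_dg (dg kap - {b. removable kap b \<and> residue_pm n i b})
      else kap)"

definition bounded_parts :: "nat \<Rightarrow> (nat \<Rightarrow> nat) set" where
  "bounded_parts n = {lam. is_partition lam \<and> lam 1 \<le> 2 * n \<and>
     (\<forall>i. 1 \<le> i \<and> i < plen lam \<and> lam i \<le> n \<longrightarrow> lam i > lam (i + 1))}"

definition pmap :: "nat \<Rightarrow> (nat \<Rightarrow> nat) \<Rightarrow> (nat \<Rightarrow> nat)" where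
  "pmap n kap = (\<lambda>b.
     if 1 \<le> b \<and> b \<le> card {(i, j) \<in> dg kap. i = j}
     then 1 + card {j. (b, j) \<in> dg kap \<and> b < j \<and> hl kap (b, j) < 2 * n}
     else 0)"

definition pinv :: "nat \<Rightarrow> (nat \<Rightarrow> nat) \<Rightarrow> (nat \<Rightarrow> nat)" where
  "pinv n = inv_into (sym_cores n) (pmap n)"

definition eps :: "nat \<Rightarrow> nat \<Rightarrow> nat" where
  "eps a = (\<lambda>i. if i = a then 1 else 0)"

definition addable_rows :: "nat \<Rightarrow> nat \<Rightarrow> (nat \<Rightarrow> nat) \<Rightarrow> nat set" where
  "addable_rows n i kap =
     {c. \<exists>d. addable kap (c, d) \<and> residue_pm n i (c, d) \<and> content (c, d) \<ge> 0}"

definition removable_rows :: "nat \<Rightarrow> nat \<Rightarrow> (nat \<Rightarrow> nat) \<Rightarrow> nat set" where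
  "removable_rows n i kap =
     {c. \<exists>d. removable kap (c, d) \<and> residue_pm n i (c, d) \<and> content (c, d) \<ge> 0}"

end

theory Submission
  imports Defs
begin

text \<open>
  A partition \<open>lam\<close> is encoded by its set of beads \<open>lam r - r\<close>. Symmetry means that \<open>x \<mapsto> -1 - x\<close>
  exchanges beads and gaps, and being a \<open>2n\<close>-core means that the bead set is closed under
  subtraction of \<open>2n\<close>. The entry of \<open>pmap n kap\<close> in a row with bead \<open>x \<ge> 0\<close> is \<open>x + 1\<close> if \<open>x < n\<close>,
  and one more than the number of gaps in the window \<open>(x - 2n, x]\<close> otherwise. Adding corners of
  residue \<open>\<plusminus> i\<close> moves beads up by one. For large beads the number of gaps in the window grows only
  if the new position was the lowest gap of its residue class, and by the reflection symmetry this
  happens for exactly one moving bead, the lowest one that is at least \<open>-1\<close>; its row is \<open>a\<close>.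
  Removing corners is the inverse operation.
\<close>

section \<open>Beads of a partition\<close>

text \<open>Beads decrease strictly with the row, so the maxima defining \<open>a\<close> and
  \<open>r\<close> pick the lowest moving bead. An addable corner has content one more than the bead
  of its row, which is where the bound \<open>- 1\<close> comes from. The threshold \<open>n\<close>
  arises because the entry for a bead \<open>y\<close> counts gaps \<open>x < y\<close> under two
  lower bounds, \<open>- 1 - y < x\<close> (strictly right of the diagonal) and
  \<open>y - 2n < x\<close> (hook length below \<open>2n\<close>); the first is the stronger one
  exactly for \<open>y < n\<close>.

  As \<open>pinv\<close> is an \<open>inv_into\<close>, the formulas carry information only once
  \<open>pmap\<close> is known to map the symmetric cores injectively onto the bounded partitions.
  This is proved as well, and surjectivity reuses the analysis of raising. Weights are never
  followed through a removal: the lowered core is raised back, and the result for addition is read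
  in reverse.\<close>

definition bead :: "(nat \<Rightarrow> nat) \<Rightarrow> nat \<Rightarrow> int" where
  "bead lam r = int (lam r) - int r"

definition beads :: "(nat \<Rightarrow> nat) \<Rightarrow> int set" where
  "beads lam = bead lam ` {1..}"

lemma bead_in_beads: "1 \<le> r \<Longrightarrow> bead lam r \<in> beads lam"
  by (simp add: beads_def)

lemma beadsE:
  assumes "x \<in> beads lam"
  obtains r where "1 \<le> r" "x = bead lam r"
  using assms by (auto simp: beads_def)

lemma partition_antimono:
  assumes "is_partition lam" "1 \<le> i" "i \<le> j"
  shows "lam j \<le> lam i"
  using assms(3)
proof (induction j rule: dec_induct)
  case (step k)
  moreover have "lam (k + 1) \<le> lam k"
    using assms(1,2) step(1) by (simp add: is_partition_def)
  ultimately show ?case by simp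
qed simp

lemma bead_less:
  assumes "is_partition lam" "1 \<le> i" "i < j"
  shows "bead lam j < bead lam i"
  using partition_antimono[OF assms(1,2), of j] assms(3) by (simp add: bead_def)

lemma bead_less_iff:
  assumes "is_partition lam" "1 \<le> i" "1 \<le> j"
  shows "bead lam j < bead lam i \<longleftrightarrow> i < j"
  using bead_less[OF assms(1), of i j] bead_less[OF assms(1), of j i] assms(2,3)
  by (cases i j rule: linorder_cases) auto

lemma bead_eq_iff:
  assumes "is_partition lam" "1 \<le> i" "1 \<le> j"
  shows "bead lam i = bead lam j \<longleftrightarrow> i = j"
  using bead_less[OF assms(1), of i j] bead_less[OF assms(1), of j i] assms(2,3)
  by (cases i j rule: linorder_cases) auto

lemma partition_support:
  assumes "is_partition lam"
  shows "{i. lam i \<noteq> 0} = {1..plen lam}"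
proof -
  let ?S = "{i. lam i \<noteq> 0}"
  have fin: "finite ?S" and zero: "lam 0 = 0"
    using assms by (auto simp: is_partition_def)
  have down: "i \<in> ?S" if "j \<in> ?S" "1 \<le> i" "i \<le> j" for i j
    using partition_antimono[OF assms that(2,3)] that(1) by auto
  have pos: "1 \<le> i" if "i \<in> ?S" for i
    using that zero by (cases i) auto
  have "\<exists>k. ?S = {1..k}"
  proof (cases "?S = {}")
    case True
    then show ?thesis by (intro exI[of _ 0]) auto
  next
    case False
    have "?S \<subseteq> {1..Max ?S}" using Max_ge[OF fin] pos by (meson atLeastAtMost_iff subsetI)
    moreover have "{1..Max ?S} \<subseteq> ?S" using down[OF Max_in[OF fin False]] by (meson atLeastAtMost_iff subsetI)
    ultimately have "?S = {1..Max ?S}" by (rule equalityI)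
    then show ?thesis by (rule exI)
  qed
  then obtain k where k: "?S = {1..k}" ..
  then have "plen lam = k" by (simp add: plen_def)
  with k show ?thesis by simp
qed

text \<open>Lengthening row \<open>r\<close> by one moves its bead up one step; the preceding row
  leaves room for this exactly when the next position is free.\<close>

lemma addable_iff:
  assumes "is_partition lam"
  shows "addable lam (r, c) \<longleftrightarrow> 1 \<le> r \<and> c = lam r + 1 \<and> bead lam r + 1 \<notin> beads lam"
proof
  assume "addable lam (r, c)"
  then obtain mu where mu: "is_partition mu" "dg mu = insert (r, c) (dg lam)"
    and nin: "(r, c) \<notin> dg lam"
    by (auto simp: addable_def)
  have "(r, c) \<in> dg mu" using mu(2) by simp
  then have mem: "1 \<le> r" "1 \<le> c" "c \<le> mu r"
    by (auto simp: dg_def)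
  have "lam r < c" using nin mem by (auto simp: dg_def)
  then have "(r, lam r + 1) \<in> dg mu" using mem by (simp add: dg_def)
  then have "(r, lam r + 1) \<in> insert (r, c) (dg lam)" using mu(2) by simp
  then have c: "c = lam r + 1" by (simp add: dg_def)
  have "bead lam r + 1 \<notin> beads lam"
  proof
    assume "bead lam r + 1 \<in> beads lam"
    then obtain s where s: "1 \<le> s" "bead lam r + 1 = bead lam s" by (rule beadsE)
    then have "s < r" using bead_less_iff[OF assms s(1) mem(1)] by simp
    then have "(s, c) \<in> dg mu"
      using partition_antimono[OF mu(1) s(1), of r] s(1) mem by (simp add: dg_def)
    then have "(s, c) \<in> dg lam" using mu(2) \<open>s < r\<close> by simp
    then have "c \<le> lam s" by (simp add: dg_def)
    then show False using s(2) c \<open>s < r\<close> by (simp add: bead_def)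
  qed
  then show "1 \<le> r \<and> c = lam r + 1 \<and> bead lam r + 1 \<notin> beads lam"
    using mem c by simp
next
  assume *: "1 \<le> r \<and> c = lam r + 1 \<and> bead lam r + 1 \<notin> beads lam"
  let ?mu = "lam(r := lam r + 1)"
  have adj: "lam r + 1 \<le> lam i" if "1 \<le> i" "i + 1 = r" for i
  proof (rule ccontr)
    assume "\<not> ?thesis"
    then have "lam i = lam r" using partition_antimono[OF assms that(1), of r] that(2) by simp
    then have "bead lam i = bead lam r + 1" using that(2) by (auto simp: bead_def)
    then show False using * bead_in_beads[OF that(1), of lam] by simp
  qed
  have "?mu (i + 1) \<le> ?mu i" if "1 \<le> i" for i
    using adj[OF that] partition_antimono[OF assms that, of "i + 1"] by auto
  moreover have "?mu 0 = 0" using assms * by (simp add: is_partition_def)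
  moreover have "finite {i. ?mu i \<noteq> 0}"
    by (rule finite_subset[of _ "insert r {i. lam i \<noteq> 0}"])
      (use assms in \<open>auto simp: is_partition_def\<close>)
  ultimately have "is_partition ?mu"
    unfolding is_partition_def by blast
  moreover have "dg ?mu = insert (r, c) (dg lam)"
    using * by (auto simp: dg_def split: if_splits)
  moreover have "(r, c) \<notin> dg lam" using * by (simp add: dg_def)
  ultimately show "addable lam (r, c)" by (auto simp: addable_def)
qed

text \<open>That row \<open>r\<close> is nonempty is implied: an empty row is followed by another
  empty row, whose bead sits one lower and blocks the move.\<close>

lemma removable_iff:
  assumes "is_partition lam"
  shows "removable lam (r, c) \<longleftrightarrow> 1 \<le> r \<and> c = lam r \<and> bead lam r - 1 \<notin> beads lam"
proof
  assume "removable lam (r, c)"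
  then obtain mu where mu: "is_partition mu" "dg mu = dg lam - {(r, c)}"
    and inn: "(r, c) \<in> dg lam"
    by (auto simp: removable_def)
  have mem: "1 \<le> r" "1 \<le> c" "c \<le> lam r"
    using inn by (auto simp: dg_def)
  have "(r, c) \<notin> dg mu" using mu(2) by simp
  then have nmu: "mu r < c" using mem by (simp add: dg_def)
  have c: "c = lam r"
  proof (rule ccontr)
    assume "c \<noteq> lam r"
    then have "(r, lam r) \<in> dg mu" using mu(2) mem by (simp add: dg_def)
    then show False using nmu mem by (simp add: dg_def)
  qed
  have "bead lam r - 1 \<notin> beads lam"
  proof
    assume "bead lam r - 1 \<in> beads lam"
    then obtain s where s: "1 \<le> s" "bead lam r - 1 = bead lam s" by (rule beadsE)
    then have "r < s" using bead_less_iff[OF assms mem(1) s(1)] by simp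
    then have "lam s = c" "s = r + 1"
      using s(2) partition_antimono[OF assms mem(1), of s] c by (auto simp: bead_def)
    then have "(s, c) \<in> dg lam" using mem by (simp add: dg_def)
    then have "(s, c) \<in> dg mu" using mu(2) \<open>r < s\<close> by simp
    then show False
      using partition_antimono[OF mu(1) mem(1), of s] nmu \<open>r < s\<close> by (simp add: dg_def)
  qed
  then show "1 \<le> r \<and> c = lam r \<and> bead lam r - 1 \<notin> beads lam"
    using mem c by simp
next
  assume *: "1 \<le> r \<and> c = lam r \<and> bead lam r - 1 \<notin> beads lam"
  let ?mu = "lam(r := lam r - 1)"
  have lt: "lam (r + 1) < lam r"
  proof (rule ccontr)
    assume "\<not> ?thesis"
    then have "lam (r + 1) = lam r" using partition_antimono[OF assms, of r "r + 1"] * by simp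
    then have "bead lam (r + 1) = bead lam r - 1" by (simp add: bead_def)
    then show False using * bead_in_beads[of "r + 1" lam] by simp
  qed
  have "finite {i. ?mu i \<noteq> 0}"
    by (rule finite_subset[of _ "{i. lam i \<noteq> 0}"]) (use assms in \<open>auto simp: is_partition_def\<close>)
  moreover have "?mu (i + 1) \<le> ?mu i" if "1 \<le> i" for i
    using partition_antimono[OF assms that, of "i + 1"] lt by (auto simp: le_diff_conv)
  moreover have "?mu 0 = 0" using assms * by (simp add: is_partition_def)
  ultimately have "is_partition ?mu"
    unfolding is_partition_def by blast
  moreover have "dg ?mu = dg lam - {(r, c)}"
    using * lt by (auto simp: dg_def split: if_splits)
  moreover have "(r, c) \<in> dg lam" using * lt by (simp add: dg_def)
  ultimately show "removable lam (r, c)" by (auto simp: removable_def)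
qed

section \<open>Symmetric partitions\<close>

locale sym_partition =
  fixes kap :: "nat \<Rightarrow> nat"
  assumes part: "is_partition kap" and sym: "is_symmetric kap"
begin

lemma le_swap: "1 \<le> i \<Longrightarrow> 1 \<le> j \<Longrightarrow> j \<le> kap i \<longleftrightarrow> i \<le> kap j"
  using sym by (force simp: is_symmetric_def dg_def)

text \<open>By symmetry \<open>j \<le> kap i\<close> and \<open>i \<le> kap j\<close> hold or fail
  together, so the bead sum \<open>(kap i - j) + (kap j - i)\<close> is at least 0 or at most -2.
  The value -1 never occurs, which keeps beads apart from reflected beads.\<close>

lemma dg_iff_bead:
  assumes "1 \<le> i" "1 \<le> j"
  shows "(i, j) \<in> dg kap \<longleftrightarrow> bead kap i + bead kap j + 1 > 0"
  using le_swap[OF assms] assms by (auto simp: dg_def bead_def)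

lemma bead_sum_neq:
  assumes "1 \<le> i" "1 \<le> j"
  shows "bead kap i + bead kap j + 1 \<noteq> 0"
  using le_swap[OF assms] by (auto simp: bead_def)

lemma ex_bead_less: "\<exists>k. bead kap (Suc k) < x"
proof
  have "kap (Suc (kap 1 + nat \<bar>x\<bar>)) \<le> kap 1"
    by (rule partition_antimono[OF part]) auto
  then show "bead kap (Suc (kap 1 + nat \<bar>x\<bar>)) < x"
    by (simp add: bead_def)
qed

lemma non_bead:
  assumes "x \<notin> beads kap"
  obtains j where "1 \<le> j" "x = -1 - bead kap j"
proof -
  define k where "k = (LEAST k. bead kap (Suc k) < x)"
  have k: "bead kap (Suc k) < x"
    unfolding k_def by (rule LeastI_ex) (rule ex_bead_less)
  have k': "x < bead kap k" if "1 \<le> k"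
  proof -
    have "\<not> bead kap (Suc (k - 1)) < x"
      using not_less_Least[of "k - 1" "\<lambda>k. bead kap (Suc k) < x"] that by (simp add: k_def)
    moreover have "bead kap k \<noteq> x" using assms bead_in_beads[OF that, of kap] by auto
    ultimately show ?thesis using that by simp
  qed
  \<comment> \<open>\<open>k\<close> counts the beads above \<open>x\<close>, and \<open>j\<close>
    is the column belonging to the gap: row \<open>k\<close> still reaches it and row
    \<open>k + 1\<close> does not, so \<open>kap j = k\<close> by symmetry.\<close>
  define j where "j = nat (x + 1 + int k)"
  have j: "1 \<le> j" "int j = x + 1 + int k"
    using k by (auto simp: j_def bead_def)
  have "k \<le> kap j"
  proof (cases "k = 0")
    case False
    then show ?thesis using k' le_swap[of k j] j by (simp add: bead_def)
  qed simp
  moreover have "\<not> Suc k \<le> kap j"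
    using k le_swap[of "Suc k" j] j by (simp add: bead_def)
  ultimately show ?thesis using that[of j] j by (simp add: bead_def)
qed

lemma beads_reflect: "- 1 - x \<in> beads kap \<longleftrightarrow> x \<notin> beads kap"
proof
  assume "- 1 - x \<in> beads kap"
  then obtain j where j: "1 \<le> j" "- 1 - x = bead kap j" by (rule beadsE)
  show "x \<notin> beads kap"
  proof
    assume "x \<in> beads kap"
    then obtain i where "1 \<le> i" "x = bead kap i" by (rule beadsE)
    then show False using bead_sum_neq[of i j] j by simp
  qed
next
  assume "x \<notin> beads kap"
  then obtain j where "1 \<le> j" "x = -1 - bead kap j" by (rule non_bead)
  then show "- 1 - x \<in> beads kap" using bead_in_beads by simp
qed

text \<open>Column \<open>j\<close> has length \<open>kap j\<close> by symmetry, and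
  \<open>- 1 - bead kap j\<close> is its gap; the hook length is the distance from this gap up to
  the bead of row \<open>b\<close>.\<close>

lemma hl_bead:
  assumes "(b, j) \<in> dg kap"
  shows "int (hl kap (b, j)) = bead kap b + bead kap j + 1"
proof -
  have bj: "1 \<le> b" "1 \<le> j" "j \<le> kap b" using assms by (auto simp: dg_def)
  then have bk: "b \<le> kap j" using le_swap by simp
  have "{r'. b < r' \<and> (r', j) \<in> dg kap} = {b<..kap j}"
    using le_swap[OF _ bj(2)] bj by (auto simp: dg_def)
  moreover have "{c'. j \<le> c' \<and> (b, c') \<in> dg kap} = {j..kap b}"
    using bj by (auto simp: dg_def)
  ultimately show ?thesis using bj bk by (simp add: bead_def)
qed

text \<open>Boxes are pairs of a bead and a lower gap, with their distance as hook length, so a hook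
  of length \<open>2n\<close> is a bead with a gap exactly \<open>2n\<close> below it.\<close>

lemma core_iff:
  assumes "1 \<le> n"
  shows "is_core (2 * n) kap \<longleftrightarrow> (\<forall>x\<in>beads kap. x - 2 * int n \<in> beads kap)"
proof
  assume core: "is_core (2 * n) kap"
  show "\<forall>x\<in>beads kap. x - 2 * int n \<in> beads kap"
  proof (rule ballI, rule ccontr)
    fix x assume x: "x \<in> beads kap" "x - 2 * int n \<notin> beads kap"
    obtain b where b: "1 \<le> b" "x = bead kap b" using x(1) by (rule beadsE)
    obtain j where j: "1 \<le> j" "x - 2 * int n = -1 - bead kap j" using x(2) by (rule non_bead)
    have "(b, j) \<in> dg kap" using dg_iff_bead[OF b(1) j(1)] b j assms by simp
    moreover from hl_bead[OF this] have "hl kap (b, j) = 2 * n" using b j by simp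
    ultimately show False using core by (auto simp: is_core_def)
  qed
next
  assume *: "\<forall>x\<in>beads kap. x - 2 * int n \<in> beads kap"
  have "hl kap (b, j) \<noteq> 2 * n" if "(b, j) \<in> dg kap" for b j
  proof
    assume "hl kap (b, j) = 2 * n"
    then have "-1 - bead kap j = bead kap b - 2 * int n"
      using hl_bead[OF that] by simp
    moreover have "1 \<le> b" "1 \<le> j" using that by (auto simp: dg_def)
    ultimately have "-1 - bead kap j \<in> beads kap" using * bead_in_beads by simp
    then show False using beads_reflect bead_in_beads[OF \<open>1 \<le> j\<close>] by blast
  qed
  then show "is_core (2 * n) kap" using part by (auto simp: is_core_def)
qed

lemma addable_swap:
  assumes "addable kap (r, c)"
  shows "addable kap (c, r)"
proof -
  have rc: "1 \<le> r" "c = kap r + 1" "bead kap r + 1 \<notin> beads kap"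
    using assms addable_iff[OF part] by auto
  obtain j where j: "1 \<le> j" "bead kap r + 1 = -1 - bead kap j" using rc(3) by (rule non_bead)
  \<comment> \<open>The equation says that \<open>j - kap r - 1\<close> and
    \<open>r - kap j - 1\<close> add up to 0. By \<open>le_swap\<close> they are both negative or
    both nonnegative, so both vanish.\<close>
  have "j = c" "r = kap j + 1"
    using j(2) rc(2) le_swap[OF rc(1) j(1)] by (auto simp: bead_def)
  moreover have "bead kap j + 1 = - 1 - bead kap r" using j(2) by simp
  then have "bead kap j + 1 \<notin> beads kap"
    using beads_reflect[of "bead kap r"] bead_in_beads[OF rc(1), of kap] by metis
  ultimately show ?thesis using addable_iff[OF part] j(1) by simp
qed

lemma removable_swap:
  assumes "removable kap (r, c)"
  shows "removable kap (c, r)"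
proof -
  have rc: "1 \<le> r" "c = kap r" "bead kap r - 1 \<notin> beads kap"
    using assms removable_iff[OF part] by auto
  obtain j where j: "1 \<le> j" "bead kap r - 1 = -1 - bead kap j" using rc(3) by (rule non_bead)
  have "j = c" "r = kap j"
    using j(2) rc(2) le_swap[OF rc(1) j(1)] by (auto simp: bead_def)
  moreover have "bead kap j - 1 = - 1 - bead kap r" using j(2) by simp
  then have "bead kap j - 1 \<notin> beads kap"
    using beads_reflect[of "bead kap r"] bead_in_beads[OF rc(1), of kap] by metis
  ultimately show ?thesis using removable_iff[OF part] j(1) by simp
qed

end

lemma sym_cores_iff:
  assumes "1 \<le> n"
  shows "kap \<in> sym_cores n \<longleftrightarrow> is_partition kap \<and> is_symmetric kap \<and>
    (\<forall>x\<in>beads kap. x - 2 * int n \<in> beads kap)"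
  using sym_partition.core_iff[OF sym_partition.intro assms]
  by (auto simp: sym_cores_def is_core_def)

lemma sym_cores_sym_partition: "kap \<in> sym_cores n \<Longrightarrow> sym_partition kap"
  by (simp add: sym_cores_def is_core_def sym_partition_def)

section \<open>Bead sets of symmetric cores\<close>

definition gaps :: "nat \<Rightarrow> int set \<Rightarrow> int \<Rightarrow> nat" where
  "gaps n B y = card {x. y - 2 * int n < x \<and> x \<le> y \<and> x \<notin> B}"

definition wt :: "nat \<Rightarrow> int set \<Rightarrow> int \<Rightarrow> nat" where
  "wt n B x = (if x < int n then nat x + 1 else gaps n B x + 1)"

text \<open>Bead sets are abstracted from partitions because the counting lemmas are applied to two
  sets side by side: \<open>B\<close> and its lift, or the beads of two cores.\<close>

locale core_set =
  fixes n :: nat and B :: "int set"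
  assumes n_pos: "1 \<le> n"
    and reflect: "- 1 - x \<in> B \<longleftrightarrow> x \<notin> B"
    and down: "x \<in> B \<Longrightarrow> x - 2 * int n \<in> B"
begin

section \<open>Counting gaps in windows of length \<open>2n\<close>\<close>

lemma down_dvd:
  assumes "x \<in> B" "2 * int n dvd x - y" "y \<le> x"
  shows "y \<in> B"
proof -
  have *: "x - 2 * int n * int k \<in> B" for k
  proof (induction k)
    case (Suc k)
    then show ?case using down[OF Suc] by (simp add: algebra_simps)
  qed (use assms in simp)
  obtain k where k: "x - y = 2 * int n * k" using assms(2) by (rule dvdE)
  have "0 \<le> k" using k assms(3) n_pos
    by (metis diff_ge_0_iff_ge mult_pos_pos of_nat_0_less_iff less_le_trans zero_less_one zero_less_numeral zero_le_mult_iff not_less)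
  then show ?thesis using *[of "nat k"] k by (simp add: algebra_simps)
qed

text \<open>Sliding the window up by one drops \<open>y + 1 - 2n\<close> and gains
  \<open>y + 1\<close>. The dropped position is added on the left, which avoids subtraction of
  natural numbers.\<close>

lemma gaps_shift:
  "gaps n B (y + 1) + of_bool (y + 1 - 2 * int n \<notin> B) = gaps n B y + of_bool (y + 1 \<notin> B)"
proof -
  let ?S = "{x. y + 1 - 2 * int n < x \<and> x \<le> y \<and> x \<notin> B}"
  have fin: "finite ?S" by (rule finite_subset[of _ "{y + 1 - 2 * int n..y}"]) auto
  have "{x. y + 1 - 2 * int n < x \<and> x \<le> y + 1 \<and> x \<notin> B} =
      (if y + 1 \<notin> B then insert (y + 1) ?S else ?S)"
    using n_pos by (auto simp: le_less)
  then have 1: "gaps n B (y + 1) = card ?S + of_bool (y + 1 \<notin> B)"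
    using fin by (simp add: gaps_def)
  have "{x. y - 2 * int n < x \<and> x \<le> y \<and> x \<notin> B} =
      (if y + 1 - 2 * int n \<notin> B then insert (y + 1 - 2 * int n) ?S else ?S)" (is "?L = ?R")
  proof (rule set_eqI)
    fix x
    show "x \<in> ?L \<longleftrightarrow> x \<in> ?R"
    proof (cases "x = y + 1 - 2 * int n")
      case True
      then show ?thesis using n_pos by simp
    next
      case False
      then have "y - 2 * int n < x \<longleftrightarrow> y + 1 - 2 * int n < x" by linarith
      then show ?thesis using False by simp
    qed
  qed
  then have "gaps n B y = card ?S + of_bool (y + 1 - 2 * int n \<notin> B)"
    using fin by (simp add: gaps_def)
  with 1 show ?thesis by simp
qed

lemma gaps_bead: "y + 1 \<in> B \<Longrightarrow> gaps n B (y + 1) = gaps n B y"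
  using gaps_shift[of y] down[of "y + 1"] by simp

lemma gaps_old: "y + 1 - 2 * int n \<notin> B \<Longrightarrow> gaps n B (y + 1) = gaps n B y"
  using gaps_shift[of y] down[of "y + 1"] by (cases "y + 1 \<in> B") auto

lemma gaps_new: "y + 1 \<notin> B \<Longrightarrow> y + 1 - 2 * int n \<in> B \<Longrightarrow> gaps n B (y + 1) = gaps n B y + 1"
  using gaps_shift[of y] by simp

text \<open>By \<open>down\<close>, if the position leaving the window is a gap, so is the one
  entering it.\<close>

lemma gaps_mono:
  assumes "x \<le> y"
  shows "gaps n B x \<le> gaps n B y"
  using assms
proof (induction y rule: int_ge_induct)
  case (step y)
  then show ?case using gaps_shift[of y] down[of "y + 1"]
    by (cases "y + 1 \<in> B"; cases "y + 1 - 2 * int n \<in> B") auto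
qed simp

lemma balanced: "card {x. - int m \<le> x \<and> x < int m \<and> x \<notin> B} = m"
proof -
  let ?C = "{x. - int m \<le> x \<and> x < int m \<and> x \<notin> B}"
  let ?D = "{x. - int m \<le> x \<and> x < int m \<and> x \<in> B}"
  have fin: "finite ?C" "finite ?D"
    by (auto intro: finite_subset[of _ "{- int m..<int m}"])
  have "bij_betw (\<lambda>x. - 1 - x) ?C ?D"
    by (rule bij_betw_byWitness[where f' = "\<lambda>x. - 1 - x"]) (auto simp: reflect)
  then have "card ?C = card ?D" by (rule bij_betw_same_card)
  moreover have "card (?C \<union> ?D) = card ?C + card ?D"
    by (rule card_Un_disjoint) (use fin in auto)
  moreover have "?C \<union> ?D = {- int m..<int m}" by auto
  ultimately show ?thesis by simp
qed

lemma gaps_center: "gaps n B (int n - 1) = n"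
proof -
  have "{x. int n - 1 - 2 * int n < x \<and> x \<le> int n - 1 \<and> x \<notin> B} =
      {x. - int n \<le> x \<and> x < int n \<and> x \<notin> B}" by auto
  then show ?thesis using balanced[of n] by (simp add: gaps_def)
qed

lemma gaps_ge: "int n \<le> y \<Longrightarrow> n \<le> gaps n B y"
  using gaps_mono[of "int n - 1" y] gaps_center by simp

text \<open>For \<open>y < n\<close> the interval strictly between \<open>- 1 - y\<close> and
  \<open>y\<close> is invariant under the reflection, so exactly half of its \<open>2y\<close>
  positions are gaps, whatever \<open>B\<close> is.\<close>

lemma wt_eq:
  assumes "0 \<le> y" "y \<in> B"
  shows "wt n B y = 1 + card {x. x \<notin> B \<and> - 1 - y < x \<and> y - 2 * int n < x \<and> x < y}"
proof (cases "y < int n")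
  case True
  then have "{x. x \<notin> B \<and> - 1 - y < x \<and> y - 2 * int n < x \<and> x < y} =
      {x. - int (nat y) \<le> x \<and> x < int (nat y) \<and> x \<notin> B}"
    using assms by auto
  then show ?thesis using True balanced[of "nat y"] by (simp add: wt_def)
next
  case False
  then have "{x. x \<notin> B \<and> - 1 - y < x \<and> y - 2 * int n < x \<and> x < y} =
      {x. y - 2 * int n < x \<and> x \<le> y \<and> x \<notin> B}"
    using assms by (auto simp: le_less)
  then show ?thesis using False by (simp add: wt_def gaps_def)
qed

lemma wt_mono:
  assumes "0 \<le> x" "x \<le> y"
  shows "wt n B x \<le> wt n B y"
  using assms gaps_mono[OF assms(2)] gaps_ge[of y] by (auto simp: wt_def)

text \<open>The bead \<open>y\<close> occupies a position of its own window, which leaves at most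
  \<open>2n - 1\<close> gaps.\<close>

lemma wt_le:
  assumes "y \<in> B"
  shows "wt n B y \<le> 2 * n"
proof -
  have "gaps n B y \<le> card {y - 2 * int n <..< y}"
    unfolding gaps_def by (rule card_mono) (use assms in \<open>auto simp: le_less\<close>)
  then show ?thesis using n_pos by (auto simp: wt_def)
qed

lemma wt_gt: "int n \<le> y \<Longrightarrow> n < wt n B y"
  using gaps_ge[of y] by (simp add: wt_def)

end

lemma sym_cores_core_set:
  assumes "1 \<le> n" "kap \<in> sym_cores n"
  shows "core_set n (beads kap)"
proof -
  interpret sym_partition kap using assms(2) by (rule sym_cores_sym_partition)
  show ?thesis
    by standard (use assms sym_cores_iff[OF assms(1)] beads_reflect in auto)
qed

section \<open>The entries of \<open>pmap\<close> as weights of beads\<close>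

lemma diagonal_card:
  assumes "is_partition kap" "1 \<le> b"
  shows "b \<le> card {(i, j) \<in> dg kap. i = j} \<longleftrightarrow> 0 \<le> bead kap b"
proof -
  let ?D = "{(i, j) \<in> dg kap. i = j}" and ?R = "{r. 1 \<le> r \<and> r \<le> kap r}"
  have "?D = (\<lambda>r. (r, r)) ` ?R" by (auto simp: dg_def)
  then have card_D: "card ?D = card ?R" by (simp add: card_image inj_on_def)
  have fin: "finite ?R"
  proof (rule finite_subset)
    show "?R \<subseteq> {..kap 1}"
    proof
      fix r assume "r \<in> ?R"
      then show "r \<in> {..kap 1}" using partition_antimono[OF assms(1), of 1 r] by simp
    qed
  qed simp
  show ?thesis
  proof
    assume "0 \<le> bead kap b"
    then have b: "b \<le> kap b" by (simp add: bead_def)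
    have "{1..b} \<subseteq> ?R"
    proof
      fix r assume "r \<in> {1..b}"
      then show "r \<in> ?R" using partition_antimono[OF assms(1), of r b] b by simp
    qed
    from card_mono[OF fin this] show "b \<le> card ?D" by (simp add: card_D)
  next
    assume b: "b \<le> card ?D"
    show "0 \<le> bead kap b"
    proof (rule ccontr)
      assume neg: "\<not> ?thesis"
      have "?R \<subseteq> {1..<b}"
      proof
        fix r assume r: "r \<in> ?R"
        have "r < b"
        proof (rule ccontr)
          assume "\<not> r < b"
          then show False using r neg partition_antimono[OF assms, of r] by (simp add: bead_def)
        qed
        then show "r \<in> {1..<b}" using r by simp
      qed
      from card_mono[OF _ this] show False using b assms(2) by (simp add: card_D)
    qed
  qed
qed

lemma pmap_wt:
  assumes "1 \<le> n" "kap \<in> sym_cores n"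
  shows "pmap n kap b =
    (if 1 \<le> b \<and> 0 \<le> bead kap b then wt n (beads kap) (bead kap b) else 0)"
proof -
  interpret sym_partition kap using assms(2) by (rule sym_cores_sym_partition)
  interpret core_set n "beads kap" using assms by (rule sym_cores_core_set)
  show ?thesis
  proof (cases "1 \<le> b \<and> 0 \<le> bead kap b")
    case False
    then show ?thesis using diagonal_card[OF part, of b] by (auto simp: pmap_def)
  next
    case True
    let ?y = "bead kap b"
    let ?J = "{j. (b, j) \<in> dg kap \<and> b < j \<and> hl kap (b, j) < 2 * n}"
    let ?X = "{x. x \<notin> beads kap \<and> - 1 - ?y < x \<and> ?y - 2 * int n < x \<and> x < ?y}"
    \<comment> \<open>Column \<open>j\<close> is sent to its gap: \<open>b < j\<close> becomes the
      bound \<open>- 1 - ?y < x\<close>, the hook condition the bound \<open>?y - 2n < x\<close>,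
      and membership in the diagram the bound \<open>x < ?y\<close>.\<close>
    have J: "j \<in> ?J \<longleftrightarrow> 1 \<le> j \<and> - 1 - bead kap j \<in> ?X" for j
    proof (cases "1 \<le> j \<and> (b, j) \<in> dg kap")
      case j: True
      have "- 1 - bead kap j \<notin> beads kap"
        using reflect bead_in_beads j by simp
      then show ?thesis
        using hl_bead[of b j] j True dg_iff_bead[of b j] bead_less_iff[OF part, of b j]
        by auto
    next
      case False
      then show ?thesis using dg_iff_bead[of b j] True by (auto simp: dg_def)
    qed
    have "bij_betw (\<lambda>j. - 1 - bead kap j) ?J ?X"
    proof (rule bij_betw_imageI)
      show "inj_on (\<lambda>j. - 1 - bead kap j) ?J"
        using bead_eq_iff[OF part] J by (auto simp: inj_on_def simp del: mem_Collect_eq)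
      show "(\<lambda>j. - 1 - bead kap j) ` ?J = ?X"
      proof (intro equalityI subsetI)
        fix x assume x: "x \<in> ?X"
        then obtain j where "1 \<le> j" "x = - 1 - bead kap j" using non_bead by blast
        then show "x \<in> (\<lambda>j. - 1 - bead kap j) ` ?J" using x J by blast
      qed (use J in blast)
    qed
    then have "card ?J = card ?X" by (rule bij_betw_same_card)
    then show ?thesis
      using True diagonal_card[OF part, of b] wt_eq[of ?y] bead_in_beads[of b kap]
      by (simp add: pmap_def)
  qed
qed

section \<open>Residues and raised bead sets\<close>

definition colour :: "nat \<Rightarrow> nat \<Rightarrow> int \<Rightarrow> bool" where
  "colour n i x \<longleftrightarrow>
    x mod (2 * int n) = int i mod (2 * int n) \<or> x mod (2 * int n) = (2 * int n - int i) mod (2 * int n)"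

lemma residue_pm_colour: "residue_pm n i b \<longleftrightarrow> colour n i (content b)"
  by (simp add: residue_pm_def residue_def colour_def)

lemma colour_iff: "colour n i x \<longleftrightarrow> 2 * int n dvd x - int i \<or> 2 * int n dvd x + int i"
proof -
  have "x - (2 * int n - int i) = x + int i - 2 * int n" by simp
  then show ?thesis by (simp add: colour_def mod_eq_dvd_iff dvd_diff_right_iff)
qed

lemma colour_uminus: "colour n i (- x) \<longleftrightarrow> colour n i x"
proof -
  have "2 * int n dvd - x - int i \<longleftrightarrow> 2 * int n dvd x + int i"
    using dvd_minus_iff[of "2 * int n" "x + int i"] by simp
  moreover have "2 * int n dvd - x + int i \<longleftrightarrow> 2 * int n dvd x - int i"
    using dvd_minus_iff[of "2 * int n" "x - int i"] by simp
  ultimately show ?thesis by (auto simp: colour_iff)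
qed

lemma colour_shift: "colour n i (x - 2 * int n) \<longleftrightarrow> colour n i x"
  by (simp add: colour_def)

text \<open>Both classes have the parity of \<open>i\<close>, as \<open>2n\<close> is even. Hence
  the pairs \<open>x - 1\<close>, \<open>x\<close> with \<open>x\<close> coloured are
  disjoint.\<close>

lemma colour_succ:
  assumes "colour n i x"
  shows "\<not> colour n i (x + 1)"
proof -
  have "even y" if "2 * int n dvd y" for y
    using that by (meson dvd_mult_left)
  then have "even (y + int i)" if "colour n i y" for y
    using that by (fastforce simp: colour_iff)
  from this[of x] this[of "x + 1"] assms show ?thesis by auto
qed

lemma colour_cong:
  assumes "colour n i x" "colour n i y"
  shows "2 * int n dvd x - y \<or> 2 * int n dvd x + y"
proof -
  have "x - y = (x - int i) - (y - int i)" "x - y = (x + int i) - (y + int i)"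
    "x + y = (x - int i) + (y + int i)" "x + y = (x + int i) + (y - int i)" by simp_all
  then show ?thesis using assms dvd_diff dvd_add unfolding colour_iff by metis
qed

section \<open>Moving all movable beads up by one\<close>

definition movable :: "nat \<Rightarrow> nat \<Rightarrow> int set \<Rightarrow> int set" where
  "movable n i B = {x. x \<in> B \<and> x + 1 \<notin> B \<and> colour n i (x + 1)}"

definition lift_beads :: "nat \<Rightarrow> nat \<Rightarrow> int set \<Rightarrow> int set" where
  "lift_beads n i B = {x. (x \<in> B \<and> x \<notin> movable n i B) \<or> x - 1 \<in> movable n i B}"

context core_set
begin

text \<open>Reflection exchanges beads with gaps and reverses the order, so a bead just below a gap
  again becomes such a pair. In the diagram this is the transposed corner.\<close>

lemma movable_reflect:
  assumes "x \<in> movable n i B"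
  shows "- 2 - x \<in> movable n i B"
proof -
  have "- 1 - (x + 1) \<in> B" "- 1 - x \<notin> B" "colour n i (- (x + 1))"
    using assms reflect[of "x + 1"] reflect[of x] colour_uminus[of n i "x + 1"]
    by (simp_all add: movable_def)
  moreover have "- 1 - (x + 1) = - 2 - x" "- 2 - x + 1 = - 1 - x" "- (x + 1) = - 2 - x + 1"
    by simp_all
  ultimately show ?thesis by (simp add: movable_def del: minus_add_distrib)
qed

text \<open>Take a bead \<open>u\<close> above a gap \<open>u - 1\<close>, with \<open>u\<close>
  congruent to the gap \<open>m + 1\<close>: the bead of the higher pair, shifted down by multiples
  of \<open>2n\<close>, would fill the gap of the lower one. The opposite residue reduces to this by
  reflection. In the diagram: a core has no addable and removable corners of equal residue up to
  sign.\<close>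

lemma no_descent:
  assumes m: "m \<in> movable n i B" and x: "x \<in> B" "colour n i x"
  shows "x - 1 \<in> B"
proof (rule ccontr)
  assume y: "x - 1 \<notin> B"
  have m': "m \<in> B" "m + 1 \<notin> B" "colour n i (m + 1)"
    using m by (auto simp: movable_def)
  have *: False if u: "u \<in> B" "u - 1 \<notin> B" "2 * int n dvd u - (m + 1)" for u
  proof (cases "m + 1 \<le> u")
    case True
    then show False using down_dvd[of u "m + 1"] u m' by simp
  next
    case False
    have "2 * int n dvd m - (u - 1)"
      using u(3) dvd_minus_iff[of "2 * int n" "u - (m + 1)"] by (simp add: algebra_simps)
    then show False using down_dvd[of m "u - 1"] u m' False by simp
  qed
  have r: "- x \<in> B" "- x - 1 \<notin> B"
    using reflect[of "x - 1"] reflect[of x] x y by (simp_all add: minus_diff_commute)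
  have "- x - (m + 1) = - (x + (m + 1))" by simp
  then have "2 * int n dvd x - (m + 1) \<or> 2 * int n dvd - x - (m + 1)"
    using colour_cong[OF x(2) m'(3)] dvd_minus_iff[of "2 * int n" "x + (m + 1)"] by metis
  then show False using *[of x] *[of "- x"] x y r by auto
qed

text \<open>By \<open>down\<close>, gaps persist upwards within a class, so if \<open>x - 2n\<close>
  can move, then so can a bead \<open>x\<close>. Below a moving bead, \<open>colour_succ\<close>
  prevents a bead already sitting at the target from moving away.\<close>

lemma lift_down:
  assumes "x \<in> lift_beads n i B"
  shows "x - 2 * int n \<in> lift_beads n i B"
proof -
  let ?M = "movable n i B"
  from assms consider "x \<in> B" "x \<notin> ?M" | "x - 1 \<in> ?M" by (auto simp: lift_beads_def)
  then show ?thesis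
  proof cases
    case 1
    have "x - 2 * int n \<notin> ?M"
    proof
      assume "x - 2 * int n \<in> ?M"
      then have "x + 1 - 2 * int n \<notin> B" "colour n i (x + 1 - 2 * int n)"
        by (simp_all add: movable_def algebra_simps)
      then have "x + 1 \<notin> B" "colour n i (x + 1)"
        using down[of "x + 1"] colour_shift[of n i "x + 1"] by auto
      then show False using 1 by (simp add: movable_def)
    qed
    then show ?thesis using 1 down by (simp add: lift_beads_def)
  next
    case 2
    then have c: "x - 1 \<in> B" "colour n i x" by (auto simp: movable_def)
    have b: "x - 2 * int n - 1 \<in> B" "colour n i (x - 2 * int n)"
      using down[OF c(1)] c(2) colour_shift by (simp_all add: algebra_simps)
    show ?thesis
    proof (cases "x - 2 * int n \<in> B")
      case True
      moreover have "x - 2 * int n \<notin> ?M"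
        using colour_succ[OF b(2)] by (simp add: movable_def)
      ultimately show ?thesis by (simp add: lift_beads_def)
    next
      case False
      then have "x - 2 * int n - 1 \<in> ?M" using b by (simp add: movable_def)
      then show ?thesis by (simp add: lift_beads_def)
    qed
  qed
qed

text \<open>
  The lifted set is the image of \<open>B\<close> under the involution of the integers that exchanges \<open>x - 1\<close>
  and \<open>x\<close> whenever \<open>x\<close> has the given colour; no bead moves down, by \<open>no_descent\<close>. A window of length \<open>2n\<close> that does not separate such
  a pair keeps its number of gaps.
\<close>

lemma gaps_lift:
  assumes m: "m \<in> movable n i B" and y: "\<not> colour n i (y + 1)"
  shows "gaps n (lift_beads n i B) y = gaps n B y"
proof -
  define s where "s x = (if colour n i (x + 1) then x + 1 else if colour n i x then x - 1 else x)" for x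
  have ss: "s (s x) = x" for x
    using colour_succ[of n i x] colour_succ[of n i "x + 1"] colour_succ[of n i "x - 1"]
    by (auto simp: s_def)
  have mem: "x \<in> lift_beads n i B \<longleftrightarrow> s x \<in> B" for x
  proof -
    consider (a) "colour n i (x + 1)" "\<not> colour n i x" | (b) "colour n i x" "\<not> colour n i (x + 1)"
      | (c) "\<not> colour n i x" "\<not> colour n i (x + 1)"
      using colour_succ[of n i x] by auto
    then show ?thesis
    proof cases
      case a
      then show ?thesis using no_descent[OF m, of "x + 1"]
        by (auto simp: lift_beads_def s_def movable_def)
    next
      case b
      then show ?thesis using no_descent[OF m, of x]
        by (auto simp: lift_beads_def s_def movable_def)
    next
      case c
      then show ?thesis by (auto simp: lift_beads_def s_def movable_def)
    qed
  qed
  let ?W = "{x. y - 2 * int n < x \<and> x \<le> y}"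
  \<comment> \<open>The two ends of the window differ by \<open>2n\<close>, so the hypothesis on
    \<open>y + 1\<close> rules out a pair straddling either end.\<close>
  have low: "\<not> colour n i (y - 2 * int n + 1)"
    using y colour_shift[of n i "y + 1"] by (simp add: algebra_simps)
  have W: "s x \<in> ?W" if "x \<in> ?W" for x
  proof -
    have "x \<noteq> y" if "colour n i (x + 1)" using that y by auto
    moreover have "x \<noteq> y - 2 * int n + 1" if "colour n i x" using that low by auto
    ultimately show ?thesis using that by (force simp: s_def)
  qed
  have "bij_betw s {x. y - 2 * int n < x \<and> x \<le> y \<and> x \<notin> lift_beads n i B}
      {x. y - 2 * int n < x \<and> x \<le> y \<and> x \<notin> B}"
    by (rule bij_betw_byWitness[where f' = s]) (use W ss mem in auto)
  then show ?thesis unfolding gaps_def by (rule bij_betw_same_card)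
qed

text \<open>
  The point is that both \<open>m\<close> and its reflection \<open>- 2 - m\<close> move, and \<open>x\<close> is congruent to one of them
  modulo \<open>2n\<close> but larger.
\<close>

lemma movable_above_min:
  assumes m: "m \<in> movable n i B" "- 1 \<le> m" and x: "x \<in> movable n i B" "m < x"
  shows "int n \<le> x \<and> x + 1 - 2 * int n \<notin> B"
proof -
  have c: "colour n i (x + 1)" "colour n i (m + 1)" and nm: "m + 1 \<notin> B" "- 2 - m + 1 \<notin> B"
    using m x movable_reflect[OF m(1)] by (auto simp: movable_def)
  have *: "u + 2 * int n \<le> x \<and> x + 1 - 2 * int n \<notin> B"
    if u: "u + 1 \<notin> B" "2 * int n dvd x - u" "u < x" for u
  proof -
    have le: "2 * int n \<le> x - u" using zdvd_imp_le[OF u(2)] u(3) by simp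
    have "2 * int n dvd x + 1 - 2 * int n - (u + 1)"
      using u(2) by (simp add: algebra_simps dvd_diff_right_iff)
        (metis diff_diff_eq dvd_diff_right_iff dvd_refl dvd_mult2)
    then have "x + 1 - 2 * int n \<notin> B"
      using down_dvd[of "x + 1 - 2 * int n" "u + 1"] u(1) le by auto
    then show ?thesis using le by simp
  qed
  from colour_cong[OF c] have "2 * int n dvd x - m \<or> 2 * int n dvd x - (- 2 - m)"
    by (auto simp: algebra_simps)
  then show ?thesis
  proof
    assume "2 * int n dvd x - m"
    then show ?thesis using *[of m] nm m x n_pos by auto
  next
    assume "2 * int n dvd x - (- 2 - m)"
    \<comment> \<open>Here \<open>x \<ge> 2n - 2 - m\<close> and \<open>x \<ge> m + 1\<close> add up
      to \<open>2x \<ge> 2n - 1\<close>, whence \<open>n \<le> x\<close>.\<close>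
    then show ?thesis using *[of "- 2 - m"] nm m x n_pos by auto
  qed
qed

text \<open>Otherwise \<open>m - 2n\<close> is movable and so is its reflection
  \<open>2n - 2 - m\<close>. One of these is at least \<open>- 1\<close>, and both are below
  \<open>m\<close> because \<open>n \<le> m\<close>.\<close>

lemma movable_min:
  assumes m: "m \<in> movable n i B" "int n \<le> m"
    and min: "\<And>x. x \<in> movable n i B \<Longrightarrow> - 1 \<le> x \<Longrightarrow> m \<le> x"
  shows "m + 1 - 2 * int n \<in> B"
proof (rule ccontr)
  assume a: "m + 1 - 2 * int n \<notin> B"
  then have "m - 2 * int n \<in> movable n i B"
    using m(1) down[of m] colour_shift[of n i "m + 1"] by (simp add: movable_def algebra_simps)
  then have u: "m - 2 * int n \<in> movable n i B" "- 2 - (m - 2 * int n) \<in> movable n i B"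
    using movable_reflect by auto
  then have "m - 2 * int n < - 1" using min[OF u(1)] n_pos by force
  then show False using min[OF u(2)] m(2) by simp
qed

text \<open>If \<open>x + 1\<close> is coloured, the window ending at \<open>x\<close> cuts a pair
  and \<open>gaps_lift\<close> does not apply. But then \<open>x + 1\<close> is a bead that stays,
  so the window can be slid up by one in both sets without changing its count.\<close>

lemma wt_lift_stay:
  assumes m: "m \<in> movable n i B" and x: "x \<in> B" "x \<notin> movable n i B"
    and "core_set n (lift_beads n i B)"
  shows "wt n (lift_beads n i B) x = wt n B x"
proof (cases "x < int n")
  case True
  then show ?thesis by (simp add: wt_def)
next
  case False
  interpret L: core_set n "lift_beads n i B" by fact
  have "gaps n (lift_beads n i B) x = gaps n B x"
  proof (cases "colour n i (x + 1)")
    case True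
    then have x1: "x + 1 \<in> B" using x by (auto simp: movable_def)
    have c: "\<not> colour n i (x + 1 + 1)" using colour_succ[OF True] .
    then have "x + 1 \<in> lift_beads n i B" using x1 by (simp add: lift_beads_def movable_def)
    then show ?thesis using gaps_lift[OF m c] gaps_bead[OF x1] L.gaps_bead by simp
  qed (rule gaps_lift[OF m])
  with False show ?thesis by (simp add: wt_def)
qed

lemma wt_lift_min:
  assumes m: "m \<in> movable n i B" "0 \<le> m"
    and min: "\<And>x. x \<in> movable n i B \<Longrightarrow> - 1 \<le> x \<Longrightarrow> m \<le> x"
    and "core_set n (lift_beads n i B)"
  shows "wt n (lift_beads n i B) (m + 1) = wt n B m + 1"
proof -
  interpret L: core_set n "lift_beads n i B" by fact
  have c: "\<not> colour n i (m + 1 + 1)" "m + 1 \<notin> B"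
    using m colour_succ[of n i "m + 1"] by (auto simp: movable_def)
  consider "m + 1 < int n" | "m + 1 = int n" | "int n \<le> m" by linarith
  then show ?thesis
  proof cases
    case 1
    then show ?thesis using m by (simp add: wt_def nat_add_distrib)
  next
    case 2
    \<comment> \<open>The weight changes formula here: it is \<open>n\<close> at
      \<open>m = n - 1\<close>, while the window of the raised bead keeps the \<open>n\<close> gaps
      of the central window, giving \<open>n + 1\<close>.\<close>
    have "m + 1 \<in> lift_beads n i B" using m by (simp add: lift_beads_def)
    from L.gaps_bead[OF this] have "gaps n (lift_beads n i B) (int n) = n"
      using L.gaps_center 2 by (metis add_diff_cancel_right')
    then show ?thesis using 2 m by (simp add: wt_def)
  next
    case 3
    then show ?thesis
      using gaps_lift[OF m(1) c(1)] gaps_new[OF c(2) movable_min[OF m(1) 3 min]]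
      by (simp add: wt_def)
  qed
qed

lemma wt_lift_other:
  assumes m: "m \<in> movable n i B" "- 1 \<le> m" and x: "x \<in> movable n i B" "m < x"
  shows "wt n (lift_beads n i B) (x + 1) = wt n B x"
proof -
  have c: "\<not> colour n i (x + 1 + 1)"
    using x colour_succ[of n i "x + 1"] by (auto simp: movable_def)
  show ?thesis
    using gaps_lift[OF m(1) c] gaps_old[of x] movable_above_min[OF m x] by (simp add: wt_def)
qed

text \<open>The reflection \<open>x\<close> to \<open>- 2 - x\<close> is centred at
  \<open>- 1\<close>. Thus any addable corner of the right residues yields one of nonnegative
  content.\<close>

lemma movable_nonneg:
  assumes "x \<in> movable n i B"
  obtains y where "y \<in> movable n i B" "- 1 \<le> y"
  using assms movable_reflect[OF assms] by (cases "- 1 \<le> x") force+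

end

section \<open>The action on symmetric cores\<close>

text \<open>The guard \<open>1 \<le> r\<close> matters: for a partition, index 0 has the spurious
  bead 0, which may coincide with a movable bead of a genuine row.\<close>

definition raised :: "nat \<Rightarrow> nat \<Rightarrow> (nat \<Rightarrow> nat) \<Rightarrow> (nat \<Rightarrow> nat)" where
  "raised n i kap = (\<lambda>r. kap r + of_bool (1 \<le> r \<and> bead kap r \<in> movable n i (beads kap)))"

text \<open>The colour is tested at \<open>x\<close> and not at a neighbour, since a removable
  corner has the bead of its row as content.\<close>

definition droppable :: "nat \<Rightarrow> nat \<Rightarrow> int set \<Rightarrow> int set" where
  "droppable n i B = {x. x \<in> B \<and> x - 1 \<notin> B \<and> colour n i x}"

definition lowered :: "nat \<Rightarrow> nat \<Rightarrow> (nat \<Rightarrow> nat) \<Rightarrow> (nat \<Rightarrow> nat)" where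
  "lowered n i kap = (\<lambda>r. kap r - of_bool (1 \<le> r \<and> bead kap r \<in> droppable n i (beads kap)))"

lemma addable_pm_iff:
  assumes "is_partition kap"
  shows "addable kap (r, c) \<and> residue_pm n i (r, c) \<longleftrightarrow>
    1 \<le> r \<and> c = kap r + 1 \<and> bead kap r \<in> movable n i (beads kap)"
proof -
  have "content (r, kap r + 1) = bead kap r + 1" by (simp add: bead_def)
  then show ?thesis
    using bead_in_beads[of r kap] addable_iff[OF assms, of r c]
    by (auto simp: residue_pm_colour movable_def simp del: content.simps)
qed

lemma removable_pm_iff:
  assumes "is_partition kap"
  shows "removable kap (r, c) \<and> residue_pm n i (r, c) \<longleftrightarrow>
    1 \<le> r \<and> c = kap r \<and> bead kap r \<in> droppable n i (beads kap)"
proof -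
  have "content (r, kap r) = bead kap r" by (simp add: bead_def)
  then show ?thesis
    using bead_in_beads[of r kap] removable_iff[OF assms, of r c]
    by (auto simp: residue_pm_colour droppable_def simp del: content.simps)
qed

lemma addable_rows_eq:
  assumes "is_partition kap"
  shows "addable_rows n i kap =
    {r. 1 \<le> r \<and> bead kap r \<in> movable n i (beads kap) \<and> - 1 \<le> bead kap r}"
proof -
  have "r \<in> addable_rows n i kap \<longleftrightarrow>
      1 \<le> r \<and> bead kap r \<in> movable n i (beads kap) \<and> 0 \<le> content (r, kap r + 1)" for r
  proof -
    have "r \<in> addable_rows n i kap \<longleftrightarrow>
        (\<exists>d. (addable kap (r, d) \<and> residue_pm n i (r, d)) \<and> 0 \<le> content (r, d))"
      by (simp add: addable_rows_def conj_assoc del: content.simps)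
    then show ?thesis
      unfolding addable_pm_iff[OF assms] by (auto simp del: content.simps)
  qed
  moreover have "0 \<le> content (r, kap r + 1) \<longleftrightarrow> - 1 \<le> bead kap r" for r
    by (auto simp: bead_def)
  ultimately show ?thesis by blast
qed

lemma removable_rows_eq:
  assumes "is_partition kap"
  shows "removable_rows n i kap =
    {r. 1 \<le> r \<and> bead kap r \<in> droppable n i (beads kap) \<and> 0 \<le> bead kap r}"
proof -
  have "r \<in> removable_rows n i kap \<longleftrightarrow>
      1 \<le> r \<and> bead kap r \<in> droppable n i (beads kap) \<and> 0 \<le> content (r, kap r)" for r
  proof -
    have "r \<in> removable_rows n i kap \<longleftrightarrow>
        (\<exists>d. (removable kap (r, d) \<and> residue_pm n i (r, d)) \<and> 0 \<le> content (r, d))"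
      by (simp add: removable_rows_def conj_assoc del: content.simps)
    then show ?thesis
      unfolding removable_pm_iff[OF assms] by (auto simp del: content.simps)
  qed
  moreover have "0 \<le> content (r, kap r) \<longleftrightarrow> 0 \<le> bead kap r" for r
    by (auto simp: bead_def)
  ultimately show ?thesis by blast
qed

lemma residue_pm_swap: "residue_pm n i (c, r) \<longleftrightarrow> residue_pm n i (r, c)"
  using colour_uminus[of n i "content (r, c)"] by (simp add: residue_pm_colour)

lemma dg_raised:
  assumes "is_partition kap"
  shows "dg (raised n i kap) = dg kap \<union> {b. addable kap b \<and> residue_pm n i b}"
proof (rule set_eqI, clarify)
  fix r c
  show "(r, c) \<in> dg (raised n i kap) \<longleftrightarrow> (r, c) \<in> dg kap \<union> {b. addable kap b \<and> residue_pm n i b}"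
    using addable_pm_iff[OF assms, of r c n i] by (auto simp: dg_def raised_def le_Suc_eq)
qed

lemma dg_lowered:
  assumes "is_partition kap"
  shows "dg (lowered n i kap) = dg kap - {b. removable kap b \<and> residue_pm n i b}"
proof (rule set_eqI, clarify)
  fix r c
  show "(r, c) \<in> dg (lowered n i kap) \<longleftrightarrow> (r, c) \<in> dg kap - {b. removable kap b \<and> residue_pm n i b}"
    using removable_pm_iff[OF assms, of r c n i] by (auto simp: dg_def lowered_def)
qed

lemma bead_raised:
  assumes "1 \<le> r"
  shows "bead (raised n i kap) r = bead kap r + of_bool (bead kap r \<in> movable n i (beads kap))"
  using assms by (simp add: bead_def raised_def)

lemma beads_raised: "beads (raised n i kap) = lift_beads n i (beads kap)"
proof (intro equalityI subsetI)
  fix x assume "x \<in> beads (raised n i kap)"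
  then obtain r where r: "1 \<le> r" "x = bead (raised n i kap) r" by (rule beadsE)
  then show "x \<in> lift_beads n i (beads kap)"
    using bead_raised[OF r(1)] bead_in_beads[OF r(1), of kap] by (auto simp: lift_beads_def)
next
  fix x assume x: "x \<in> lift_beads n i (beads kap)"
  then consider "x \<in> beads kap" "x \<notin> movable n i (beads kap)" | "x - 1 \<in> movable n i (beads kap)"
    by (auto simp: lift_beads_def)
  then show "x \<in> beads (raised n i kap)"
  proof cases
    case 1
    then obtain r where r: "1 \<le> r" "x = bead kap r" by (auto elim: beadsE)
    then show ?thesis using bead_raised[OF r(1)] bead_in_beads[OF r(1)] 1 by (metis add_0_right of_bool_eq(1))
  next
    case 2
    then have "x - 1 \<in> beads kap" by (simp add: movable_def)
    then obtain r where r: "1 \<le> r" "x - 1 = bead kap r" by (auto elim: beadsE)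
    then have "bead (raised n i kap) r = x" using bead_raised[OF r(1), of n i kap] 2 by simp
    then show ?thesis using bead_in_beads[OF r(1)] by metis
  qed
qed

lemma raised_partition:
  assumes "is_partition kap"
  shows "is_partition (raised n i kap)"
proof -
  have "raised n i kap (r + 1) \<le> raised n i kap r" if r: "1 \<le> r" for r
  proof (cases "bead kap (r + 1) \<in> movable n i (beads kap)")
    case True
    then have "bead kap (r + 1) + 1 \<noteq> bead kap r"
      using bead_in_beads[OF r, of kap] by (auto simp: movable_def)
    then have "kap (r + 1) \<noteq> kap r" by (simp add: bead_def)
    then show ?thesis using partition_antimono[OF assms r, of "r + 1"] by (simp add: raised_def)
  next
    case False
    then show ?thesis using partition_antimono[OF assms r, of "r + 1"] by (simp add: raised_def)
  qed
  moreover have "finite {r. raised n i kap r \<noteq> 0}"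
  proof (rule finite_subset)
    \<comment> \<open>Only the first empty row can gain a box: any later one has its target occupied
      by the bead of the empty row before it.\<close>
    show "{r. raised n i kap r \<noteq> 0} \<subseteq> {r. kap r \<noteq> 0} \<union> {r. r \<le> Suc (plen kap)}"
    proof
      fix r assume r: "r \<in> {r. raised n i kap r \<noteq> 0}"
      have "r \<le> Suc (plen kap)" if "kap r = 0"
      proof (rule ccontr)
        assume "\<not> ?thesis"
        then have "r - 1 \<notin> {1..plen kap}" "1 \<le> r - 1" by auto
        then have "kap (r - 1) = 0" using partition_support[OF assms] by blast
        then have "bead kap r + 1 = bead kap (r - 1)" using that \<open>1 \<le> r - 1\<close> by (simp add: bead_def)
        then have "bead kap r \<notin> movable n i (beads kap)"
          using bead_in_beads[OF \<open>1 \<le> r - 1\<close>, of kap] by (auto simp: movable_def)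
        then show False using r that by (simp add: raised_def)
      qed
      then show "r \<in> {r. kap r \<noteq> 0} \<union> {r. r \<le> Suc (plen kap)}" by auto
    qed
    show "finite ({r. kap r \<noteq> 0} \<union> {r. r \<le> Suc (plen kap)})"
      using assms by (simp add: is_partition_def)
  qed
  ultimately show ?thesis using assms by (simp add: is_partition_def raised_def)
qed

lemma lowered_partition:
  assumes "is_partition kap"
  shows "is_partition (lowered n i kap)"
proof -
  have "lowered n i kap (r + 1) \<le> lowered n i kap r" if r: "1 \<le> r" for r
  proof (cases "bead kap r \<in> droppable n i (beads kap)")
    case True
    then have "bead kap (r + 1) \<noteq> bead kap r - 1"
      using bead_in_beads[of "r + 1" kap] by (auto simp: droppable_def)
    then have "kap (r + 1) \<noteq> kap r" by (simp add: bead_def)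
    then show ?thesis using partition_antimono[OF assms r, of "r + 1"]
      by (auto simp: lowered_def of_bool_def)
  next
    case False
    then show ?thesis using partition_antimono[OF assms r, of "r + 1"]
      by (auto simp: lowered_def of_bool_def)
  qed
  moreover have "finite {r. lowered n i kap r \<noteq> 0}"
    by (rule finite_subset[of _ "{r. kap r \<noteq> 0}"])
      (use assms in \<open>auto simp: is_partition_def lowered_def\<close>)
  ultimately show ?thesis using assms by (simp add: is_partition_def lowered_def)
qed

lemma raised_sym_core:
  assumes "1 \<le> n" "kap \<in> sym_cores n"
  shows "raised n i kap \<in> sym_cores n"
proof -
  interpret sym_partition kap using assms(2) by (rule sym_cores_sym_partition)
  interpret core_set n "beads kap" using assms by (rule sym_cores_core_set)
  have "is_symmetric (raised n i kap)"
    using sym addable_swap residue_pm_swap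
    by (auto simp: is_symmetric_def dg_raised[OF part])
  then show ?thesis
    using raised_partition[OF part] lift_down by (simp add: sym_cores_iff[OF assms(1)] beads_raised)
qed

section \<open>Removing corners in terms of beads\<close>

lemma bead_lowered:
  assumes "is_partition kap" "1 \<le> r"
  shows "bead (lowered n i kap) r = bead kap r - of_bool (bead kap r \<in> droppable n i (beads kap))"
proof (cases "bead kap r \<in> droppable n i (beads kap)")
  case True
  \<comment> \<open>A droppable bead belongs to a nonempty row, so the truncated subtraction in
    \<open>lowered\<close> is a true one.\<close>
  then have "removable kap (r, kap r)"
    using removable_pm_iff[OF assms(1)] assms(2) by blast
  then have "1 \<le> kap r" by (simp add: removable_def dg_def)
  then show ?thesis using True assms(2) by (simp add: bead_def lowered_def)
qed (simp add: bead_def lowered_def)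

lemma beads_lowered:
  assumes "is_partition kap"
  shows "beads (lowered n i kap) =
    {x. (x \<in> beads kap \<and> x \<notin> droppable n i (beads kap)) \<or> x + 1 \<in> droppable n i (beads kap)}"
    (is "_ = ?R")
proof (intro equalityI subsetI)
  fix x assume "x \<in> beads (lowered n i kap)"
  then obtain r where r: "1 \<le> r" "x = bead (lowered n i kap) r" by (rule beadsE)
  then show "x \<in> ?R"
    using bead_lowered[OF assms r(1)] bead_in_beads[OF r(1), of kap] by auto
next
  fix x assume x: "x \<in> ?R"
  then consider "x \<in> beads kap" "x \<notin> droppable n i (beads kap)" | "x + 1 \<in> droppable n i (beads kap)"
    by auto
  then show "x \<in> beads (lowered n i kap)"
  proof cases
    case 1
    then obtain r where r: "1 \<le> r" "x = bead kap r" by (auto elim: beadsE)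
    then have "bead (lowered n i kap) r = x" using bead_lowered[OF assms r(1), of n i] 1 by simp
    then show ?thesis using bead_in_beads[OF r(1)] by metis
  next
    case 2
    then have "x + 1 \<in> beads kap" by (simp add: droppable_def)
    then obtain r where r: "1 \<le> r" "x + 1 = bead kap r" by (auto elim: beadsE)
    then have "bead (lowered n i kap) r = x" using bead_lowered[OF assms r(1), of n i] 2 by simp
    then show ?thesis using bead_in_beads[OF r(1)] by metis
  qed
qed

text \<open>Mirror image of \<open>lift_down\<close>: a gap at \<open>x - 1 - 2n\<close> forces a
  gap at \<open>x - 1\<close>, so if \<open>x - 2n\<close> can drop, then so can a bead
  \<open>x\<close>.\<close>

lemma lowered_sym_core:
  assumes "1 \<le> n" "kap \<in> sym_cores n"
  shows "lowered n i kap \<in> sym_cores n"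
proof -
  interpret sym_partition kap using assms(2) by (rule sym_cores_sym_partition)
  interpret core_set n "beads kap" using assms by (rule sym_cores_core_set)
  let ?B = "beads kap" and ?R = "droppable n i (beads kap)"
  have symm: "is_symmetric (lowered n i kap)"
    using sym removable_swap residue_pm_swap
    by (auto simp: is_symmetric_def dg_lowered[OF part])
  have shift: "y - 2 * int n \<in> ?R" if "y \<in> ?R" "y - 1 - 2 * int n \<notin> ?B" for y
    using that down[of y] colour_shift[of n i y] by (simp add: droppable_def algebra_simps)
  have "x - 2 * int n \<in> beads (lowered n i kap)" if "x \<in> beads (lowered n i kap)" for x
  proof -
    from that consider "x \<in> ?B" "x \<notin> ?R" | "x + 1 \<in> ?R"
      by (auto simp: beads_lowered[OF part])
    then show ?thesis
    proof cases
      case 1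
      show ?thesis
      proof (cases "x - 2 * int n \<in> ?R")
        case True
        then have "x - 1 \<notin> ?B" "colour n i x"
          using down[of "x - 1"] colour_shift[of n i x] by (auto simp: droppable_def algebra_simps)
        then show ?thesis using 1 by (simp add: droppable_def)
      next
        case False
        then show ?thesis using 1 down by (simp add: beads_lowered[OF part])
      qed
    next
      case 2
      show ?thesis
      proof (cases "x - 2 * int n \<in> ?B")
        case True
        have "\<not> colour n i x" using 2 colour_succ by (auto simp: droppable_def)
        then have "x - 2 * int n \<notin> ?R" using colour_shift by (simp add: droppable_def)
        then show ?thesis using True by (simp add: beads_lowered[OF part])
      next
        case False
        then have "x - 2 * int n + 1 \<in> ?R" using shift[OF 2] by (simp add: algebra_simps)
        then show ?thesis by (simp add: beads_lowered[OF part])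
      qed
    qed
  qed
  then show ?thesis using symm lowered_partition[OF part] by (simp add: sym_cores_iff[OF assms(1)])
qed

text \<open>As nothing was movable before, only beads that have just dropped can move, and these can
  because they vacated their targets. Raising therefore undoes lowering.\<close>

lemma movable_lowered:
  assumes part: "is_partition kap" and none: "movable n i (beads kap) = {}"
  shows "movable n i (beads (lowered n i kap)) = {x. x + 1 \<in> droppable n i (beads kap)}"
proof (intro equalityI subsetI)
  let ?B = "beads kap" and ?R = "droppable n i (beads kap)"
  fix x assume x: "x \<in> movable n i (beads (lowered n i kap))"
  then have x': "x \<in> beads (lowered n i kap)" "x + 1 \<notin> beads (lowered n i kap)" "colour n i (x + 1)"
    by (auto simp: movable_def)
  show "x \<in> {x. x + 1 \<in> ?R}"
  proof (rule ccontr)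
    assume n: "x \<notin> {x. x + 1 \<in> ?R}"
    then have "x \<in> ?B" using x'(1) by (simp add: beads_lowered[OF part])
    moreover have "x + 1 \<notin> ?B" using n x'(2) by (auto simp: beads_lowered[OF part])
    ultimately have "x \<in> movable n i ?B" using x'(3) by (simp add: movable_def)
    then show False using none by simp
  qed
next
  let ?B = "beads kap" and ?R = "droppable n i (beads kap)"
  fix x assume x: "x \<in> {x. x + 1 \<in> ?R}"
  then have c: "colour n i (x + 1)" by (simp add: droppable_def)
  then have "x + 1 + 1 \<notin> ?R" using colour_succ[OF c] by (simp add: droppable_def)
  then show "x \<in> movable n i (beads (lowered n i kap))"
    using x c by (simp add: movable_def beads_lowered[OF part])
qed

lemma raised_lowered:
  assumes "is_partition kap" "movable n i (beads kap) = {}"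
  shows "raised n i (lowered n i kap) = kap"
proof
  fix r
  show "raised n i (lowered n i kap) r = kap r"
  proof (cases "1 \<le> r")
    case True
    let ?R = "droppable n i (beads kap)"
    have "bead (raised n i (lowered n i kap)) r = bead kap r"
    proof (cases "bead kap r \<in> ?R")
      case True
      then show ?thesis
        by (simp add: bead_raised[OF \<open>1 \<le> r\<close>] bead_lowered[OF assms(1) \<open>1 \<le> r\<close>] movable_lowered[OF assms])
    next
      case False
      have "bead kap r + 1 \<notin> ?R"
        using bead_in_beads[OF \<open>1 \<le> r\<close>, of kap] by (simp add: droppable_def)
      then show ?thesis using False
        by (simp add: bead_raised[OF \<open>1 \<le> r\<close>] bead_lowered[OF assms(1) \<open>1 \<le> r\<close>] movable_lowered[OF assms])
    qed
    then show ?thesis by (simp add: bead_def)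
  qed (simp add: raised_def lowered_def)
qed

section \<open>The effect of raising on the entries of \<open>pmap\<close>\<close>

lemma pmap_raised:
  assumes n: "1 \<le> n" and kap: "kap \<in> sym_cores n"
    and a: "1 \<le> a" "bead kap a \<in> movable n i (beads kap)" "- 1 \<le> bead kap a"
    and min: "\<And>x. x \<in> movable n i (beads kap) \<Longrightarrow> - 1 \<le> x \<Longrightarrow> bead kap a \<le> x"
  shows "pmap n (raised n i kap) = (\<lambda>b. pmap n kap b + eps a b)"
proof
  fix b
  interpret sym_partition kap using kap by (rule sym_cores_sym_partition)
  interpret core_set n "beads kap" using n kap by (rule sym_cores_core_set)
  have kap': "raised n i kap \<in> sym_cores n" using n kap by (rule raised_sym_core)
  have L: "core_set n (lift_beads n i (beads kap))"
    using sym_cores_core_set[OF n kap'] by (simp add: beads_raised)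
  interpret L: core_set n "lift_beads n i (beads kap)" by (rule L)
  show "pmap n (raised n i kap) b = pmap n kap b + eps a b"
  proof (cases "1 \<le> b")
    case False
    then show ?thesis using a(1) by (simp add: pmap_def eps_def)
  next
    case b: True
    note pm = pmap_wt[OF n kap, of b] pmap_wt[OF n kap', of b] bead_raised[OF b, of n i kap] beads_raised[of n i kap]
    have ab: "bead kap b = bead kap a \<longleftrightarrow> b = a" by (rule bead_eq_iff[OF part b a(1)])
    show ?thesis
    proof (cases "bead kap b \<in> movable n i (beads kap)")
      case False
      then show ?thesis
        using pm b a(2) wt_lift_stay[OF a(2) bead_in_beads[OF b] False L] by (auto simp: eps_def)
    next
      case True
      show ?thesis
      proof (cases "b = a")
        case True
        show ?thesis
        proof (cases "0 \<le> bead kap a")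
          case nonneg: True
          show ?thesis using wt_lift_min[OF a(2) nonneg min L] pm True a nonneg by (simp add: eps_def)
        next
          case False
          \<comment> \<open>The bead enters position 0: row \<open>a\<close> acquires a diagonal
            box, and its entry changes from the default 0 to the weight 1.\<close>
          then have "bead kap a = - 1" using a(3) by simp
          then show ?thesis using pm True a n by (simp add: eps_def wt_def)
        qed
      next
        case False
        \<comment> \<open>A bead below \<open>- 1\<close> is still negative after its move, so its
          row has entry 0 before and after.\<close>
        then consider "bead kap b < - 1" | "bead kap a < bead kap b"
          using min[OF True] ab by force
        then show ?thesis
        proof cases
          case 1
          then show ?thesis using pm b True False by (simp add: eps_def)
        next
          case 2
          then show ?thesis
            using pm b True False wt_lift_other[OF a(2,3) True 2] a(3) by (simp add: eps_def)
        qed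
      qed
    qed
  qed
qed

text \<open>Nonnegative content confines the row to \<open>r \<le> kap r + 1\<close>.
  \<open>Max\<close> has its intended meaning only on a finite nonempty set.\<close>

lemma addable_rows_finite:
  assumes "is_partition kap"
  shows "finite (addable_rows n i kap)"
proof (rule finite_subset)
  show "addable_rows n i kap \<subseteq> {..kap 1 + 1}"
  proof
    fix r assume "r \<in> addable_rows n i kap"
    then have "1 \<le> r" "- 1 \<le> bead kap r" by (auto simp: addable_rows_eq[OF assms])
    then show "r \<in> {..kap 1 + 1}"
      using partition_antimono[OF assms, of 1 r] by (simp add: bead_def)
  qed
qed simp

lemma pmap_raised_Max:
  assumes n: "1 \<le> n" and kap: "kap \<in> sym_cores n" and M: "movable n i (beads kap) \<noteq> {}"
  shows "addable_rows n i kap \<noteq> {}"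
    and "pmap n (raised n i kap) = (\<lambda>b. pmap n kap b + eps (Max (addable_rows n i kap)) b)"
proof -
  interpret sym_partition kap using kap by (rule sym_cores_sym_partition)
  interpret core_set n "beads kap" using n kap by (rule sym_cores_core_set)
  let ?A = "addable_rows n i kap"
  have row: "\<exists>r\<in>?A. bead kap r = x" if x: "x \<in> movable n i (beads kap)" "- 1 \<le> x" for x
  proof -
    have "x \<in> beads kap" using x by (simp add: movable_def)
    then obtain r where "1 \<le> r" "x = bead kap r" by (rule beadsE)
    then show ?thesis using x by (auto simp: addable_rows_eq[OF part])
  qed
  obtain y where "y \<in> movable n i (beads kap)" "- 1 \<le> y" using M movable_nonneg by blast
  then show ne: "?A \<noteq> {}" using row by blast
  let ?a = "Max ?A"
  have a: "1 \<le> ?a" "bead kap ?a \<in> movable n i (beads kap)" "- 1 \<le> bead kap ?a"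
    using Max_in[OF addable_rows_finite[OF part] ne] addable_rows_eq[OF part] by auto
  show "pmap n (raised n i kap) = (\<lambda>b. pmap n kap b + eps ?a b)"
  proof (rule pmap_raised[OF n kap a])
    fix x assume "x \<in> movable n i (beads kap)" "- 1 \<le> x"
    then obtain r where r: "r \<in> ?A" "bead kap r = x" using row by blast
    have "r \<le> ?a" using Max_ge[OF addable_rows_finite[OF part] r(1)] .
    then show "bead kap ?a \<le> x"
      using r addable_rows_eq[OF part] bead_less[OF part, of r ?a] by (cases "r = ?a") auto
  qed
qed

section \<open>Bijectivity of \<open>pmap\<close>\<close>

text \<open>An entry at most \<open>n\<close> can only come from a bead below \<open>n\<close>,
  where the weight is the bead plus one and hence strictly increasing.\<close>

lemma pmap_bounded:
  assumes n: "1 \<le> n" and kap: "kap \<in> sym_cores n"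
  shows "pmap n kap \<in> bounded_parts n"
proof -
  interpret sym_partition kap using kap by (rule sym_cores_sym_partition)
  interpret core_set n "beads kap" using n kap by (rule sym_cores_core_set)
  note pm = pmap_wt[OF n kap]
  have mono: "pmap n kap (i + 1) \<le> pmap n kap i" if i: "1 \<le> i" for i
    using pm[of i] pm[of "i + 1"] i bead_less[OF part i, of "i + 1"]
      wt_mono[of "bead kap (i + 1)" "bead kap i"] by auto
  have "{i. pmap n kap i \<noteq> 0} \<subseteq> {..kap 1}"
  proof
    fix i assume "i \<in> {i. pmap n kap i \<noteq> 0}"
    then have "1 \<le> i" "0 \<le> bead kap i" using pm[of i] by (auto split: if_splits)
    then show "i \<in> {..kap 1}" using partition_antimono[OF part, of 1 i] by (simp add: bead_def)
  qed
  then have "finite {i. pmap n kap i \<noteq> 0}" by (rule finite_subset) simp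
  moreover have "pmap n kap 0 = 0" by (simp add: pmap_def)
  ultimately have P: "is_partition (pmap n kap)" using mono unfolding is_partition_def by blast
  moreover have "pmap n kap 1 \<le> 2 * n"
    using pm[of 1] wt_le[OF bead_in_beads[of 1 kap]] by simp
  moreover have "pmap n kap (i + 1) < pmap n kap i"
    if i: "1 \<le> i" "i < plen (pmap n kap)" "pmap n kap i \<le> n" for i
  proof -
    have "i \<in> {1..plen (pmap n kap)}" using i by simp
    then have "pmap n kap i \<noteq> 0" using partition_support[OF P] by blast
    then have b: "0 \<le> bead kap i" "pmap n kap i = wt n (beads kap) (bead kap i)"
      using pm[of i] by (auto split: if_splits)
    then have s: "bead kap i < int n" using wt_gt[of "bead kap i"] i(3) by (cases "int n \<le> bead kap i") auto
    show ?thesis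
    proof (cases "0 \<le> bead kap (i + 1)")
      case True
      then show ?thesis
        using pm[of "i + 1"] b s bead_less[OF part i(1), of "i + 1"] by (simp add: wt_def)
    next
      case False
      then show ?thesis using pm[of "i + 1"] \<open>pmap n kap i \<noteq> 0\<close> by simp
    qed
  qed
  ultimately show ?thesis by (simp add: bounded_parts_def)
qed

text \<open>Reflection recovers the negative beads from the nonnegative ones, and the rows list all
  beads in decreasing order.\<close>

lemma partition_eqI:
  assumes k: "is_partition k" and l: "is_partition l"
    and eq: "\<And>x. 0 \<le> x \<Longrightarrow> x \<in> beads k \<longleftrightarrow> x \<in> beads l"
    and "is_symmetric k" "is_symmetric l"
  shows "k = l"
proof -
  interpret K: sym_partition k using assms by unfold_locales
  interpret L: sym_partition l using assms by unfold_locales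
  have all: "x \<in> beads k \<longleftrightarrow> x \<in> beads l" for x
  proof (cases "0 \<le> x")
    case False
    then show ?thesis using eq[of "- 1 - x"] K.beads_reflect[of x] L.beads_reflect[of x] by simp
  qed (rule eq)
  have "bead k r = bead l r" if "1 \<le> r" for r
    using that
  proof (induction r rule: less_induct)
    case (less r)
    \<comment> \<open>The earlier rows agree, so the bead of row \<open>r\<close> in
      \<open>q\<close> occurs in \<open>p\<close> at row \<open>r\<close> or later. Both directions
      are needed, hence the general \<open>p\<close> and \<open>q\<close>.\<close>
    have *: "bead q r \<le> bead p r" if p: "is_partition p" and q: "is_partition q"
      and sub: "\<And>x. x \<in> beads q \<Longrightarrow> x \<in> beads p"
      and IH: "\<And>s. s < r \<Longrightarrow> 1 \<le> s \<Longrightarrow> bead p s = bead q s" for p q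
    proof -
      obtain s where s: "1 \<le> s" "bead q r = bead p s"
        using sub[OF bead_in_beads[OF less.prems]] by (auto elim: beadsE)
      have "\<not> s < r"
        using IH[of s] s bead_eq_iff[OF q s(1) less.prems] by auto
      then show ?thesis using s bead_less[OF p less.prems, of s] by (cases "s = r") auto
    qed
    show ?case using *[OF k l] *[OF l k] all less.IH by (metis order_antisym)
  qed
  then have "k r = l r" if "1 \<le> r" for r using that by (simp add: bead_def)
  moreover have "k 0 = l 0" using k l by (simp add: is_partition_def)
  ultimately show ?thesis by (metis ext less_one not_le)
qed

text \<open>
  The row of \<open>y\<close> in \<open>k\<close> carries in \<open>l\<close> a bead above the gap \<open>y\<close>, which therefore has a larger weight.
\<close>

lemma pmap_neq:
  assumes n: "1 \<le> n" and k: "k \<in> sym_cores n" and l: "l \<in> sym_cores n"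
    and y: "0 \<le> y" "y \<in> beads k" "y \<notin> beads l"
    and eq: "\<And>z. 0 \<le> z \<Longrightarrow> z < y \<Longrightarrow> z \<in> beads k \<longleftrightarrow> z \<in> beads l"
  shows "pmap n k \<noteq> pmap n l"
proof
  assume pm: "pmap n k = pmap n l"
  interpret Ks: sym_partition k using k by (rule sym_cores_sym_partition)
  interpret Ls: sym_partition l using l by (rule sym_cores_sym_partition)
  interpret K: core_set n "beads k" using n k by (rule sym_cores_core_set)
  interpret L: core_set n "beads l" using n l by (rule sym_cores_core_set)
  \<comment> \<open>Agreement on the nonnegative positions below \<open>y\<close> extends by
    reflection down to \<open>- y\<close>.\<close>
  have eq': "z \<in> beads k \<longleftrightarrow> z \<in> beads l" if "- y \<le> z" "z < y" for z
    using eq[of z] eq[of "- 1 - z"] K.reflect[of z] L.reflect[of z] that by (cases "0 \<le> z") auto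
  have same: "0 \<le> bead k r \<longleftrightarrow> 0 \<le> bead l r" if "1 \<le> r" for r
    using fun_cong[OF pm, of r] pmap_wt[OF n k, of r] pmap_wt[OF n l, of r] that
    by (auto simp: wt_def split: if_splits)
  obtain b where b: "1 \<le> b" "y = bead k b" using y(2) by (rule beadsE)
  have lb: "0 \<le> bead l b" using same[OF b(1)] b y by simp
  have above: "y < bead l b"
  proof (rule ccontr)
    assume "\<not> y < bead l b"
    moreover have "bead l b \<noteq> y" using y(3) bead_in_beads[OF b(1), of l] by auto
    ultimately have less: "bead l b < y" by simp
    \<comment> \<open>Both cores have equally many beads from 0 up to below \<open>y\<close>. If the
      bead of row \<open>b\<close> in \<open>l\<close> were among them, \<open>l\<close> would have
      one more, since row \<open>b\<close> of \<open>k\<close> carries \<open>y\<close>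
      itself.\<close>
    let ?S = "\<lambda>p. {r. 1 \<le> r \<and> 0 \<le> bead p r \<and> bead p r < y}"
    have rows: "?S k = {r. b < r \<and> 0 \<le> bead k r}"
      using bead_less_iff[OF Ks.part b(1)] b by auto
    have sub: "insert b (?S k) \<subseteq> ?S l"
    proof
      fix r assume "r \<in> insert b (?S k)"
      then have r: "b \<le> r" "0 \<le> bead k r" unfolding rows using b y by auto
      then have "bead l r \<le> bead l b" using bead_less[OF Ls.part b(1), of r] by (cases "r = b") auto
      then show "r \<in> ?S l" using r b(1) same[of r] less by simp
    qed
    have img: "bead p ` ?S p = {z \<in> beads p. 0 \<le> z \<and> z < y}" for p
      by (auto simp: beads_def)
    have card: "card (?S p) = card {z \<in> beads p. 0 \<le> z \<and> z < y}" if "is_partition p" for p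
      using card_image[of "bead p" "?S p"] bead_eq_iff[OF that] img[of p] by (simp add: inj_on_def)
    have "{z \<in> beads k. 0 \<le> z \<and> z < y} = {z \<in> beads l. 0 \<le> z \<and> z < y}" using eq by blast
    then have ce: "card (?S k) = card (?S l)" using card[OF Ks.part] card[OF Ls.part] by simp
    have fin: "finite (?S p)" if "is_partition p" for p
    proof -
      have "finite (bead p ` ?S p)" by (rule finite_subset[of _ "{0..<y}"]) auto
      then show ?thesis using bead_eq_iff[OF that] by (auto intro: finite_imageD simp: inj_on_def)
    qed
    have "card (insert b (?S k)) = card (?S k) + 1" using fin[OF Ks.part] b by simp
    then show False using card_mono[OF fin[OF Ls.part] sub] ce by simp
  qed
  have w: "wt n (beads k) y = wt n (beads l) (bead l b)"
    using fun_cong[OF pm, of b] pmap_wt[OF n k, of b] pmap_wt[OF n l, of b] b y lb by simp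
  show False
  proof (cases "y < int n")
    case True
    then show False using w above L.wt_gt[of "bead l b"] y(1)
      by (cases "bead l b < int n") (auto simp: wt_def)
  next
    case False
    have "gaps n (beads k) (y - 1) = gaps n (beads l) (y - 1)"
    proof -
      have "{x. y - 1 - 2 * int n < x \<and> x \<le> y - 1 \<and> x \<notin> beads k} =
        {x. y - 1 - 2 * int n < x \<and> x \<le> y - 1 \<and> x \<notin> beads l}"
      proof (rule Collect_cong)
        fix x
        show "(y - 1 - 2 * int n < x \<and> x \<le> y - 1 \<and> x \<notin> beads k) =
          (y - 1 - 2 * int n < x \<and> x \<le> y - 1 \<and> x \<notin> beads l)"
          using eq'[of x] False by auto
      qed
      then show ?thesis by (simp add: gaps_def)
    qed
    moreover have "gaps n (beads k) y = gaps n (beads k) (y - 1)"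
      using K.gaps_bead[of "y - 1"] y by simp
    \<comment> \<open>Since \<open>y \<ge> n\<close>, position \<open>y - 2n\<close> lies in the
      range of agreement. So at \<open>y\<close> the gap count rises by one in \<open>l\<close>,
      whereas in \<open>k\<close>, where \<open>y\<close> is a bead, it does not.\<close>
    moreover have "y - 2 * int n \<in> beads l"
      using eq'[of "y - 2 * int n"] K.down[OF y(2)] False n by auto
    then have "gaps n (beads l) y = gaps n (beads l) (y - 1) + 1"
      using L.gaps_new[of "y - 1"] y by simp
    ultimately show False
      using w False above L.gaps_mono[of y "bead l b"] by (simp add: wt_def)
  qed
qed

text \<open>Distinct symmetric cores differ at some nonnegative position; \<open>pmap_neq\<close>
  applies to the least one, in whichever order puts the bead first.\<close>

lemma pmap_inj:
  assumes n: "1 \<le> n"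
  shows "inj_on (pmap n) (sym_cores n)"
proof (rule inj_onI, rule ccontr)
  fix k l assume kl: "k \<in> sym_cores n" "l \<in> sym_cores n" "pmap n k = pmap n l" "k \<noteq> l"
  define D where "D y \<longleftrightarrow> (int y \<in> beads k) \<noteq> (int y \<in> beads l)" for y
  have "\<exists>y. D y"
  proof (rule ccontr)
    assume "\<nexists>y. D y"
    then have "x \<in> beads k \<longleftrightarrow> x \<in> beads l" if "0 \<le> x" for x
      using that D_def[of "nat x"] by simp
    then have "k = l"
      using kl(1,2) by (intro partition_eqI) (auto simp: sym_cores_iff[OF n])
    then show False using kl(4) by simp
  qed
  define y where "y = (LEAST y. D y)"
  have y: "D y" unfolding y_def using \<open>\<exists>y. D y\<close> by (rule LeastI_ex)
  have "\<not> D z" if "z < y" for z using that not_less_Least y_def by metis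
  then have eq: "z \<in> beads k \<longleftrightarrow> z \<in> beads l" if "0 \<le> z" "z < int y" for z
    using that D_def[of "nat z"] by (metis nat_0_le nat_less_iff)
  show False
  proof (cases "int y \<in> beads k")
    case True
    then show False using pmap_neq[OF n kl(1,2), of "int y"] y eq kl(3) by (simp add: D_def)
  next
    case False
    then show False using pmap_neq[OF n kl(2,1), of "int y"] y eq kl(3) by (simp add: D_def)
  qed
qed

text \<open>
  Induction on the number of boxes: remove a box from the last row, take a preimage, and raise its
  bead in that row; this bead turns out to be the lowest movable one that is at least \<open>-1\<close>.
\<close>

lemma pmap_surj:
  assumes n: "1 \<le> n"
  shows "lam \<in> bounded_parts n \<Longrightarrow> \<exists>kap\<in>sym_cores n. pmap n kap = lam"
proof (induction "\<Sum>r\<in>{1..plen lam}. lam r" arbitrary: lam rule: less_induct)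
  case less
  have P: "is_partition lam" and l1: "lam 1 \<le> 2 * n"
    and strict: "\<And>i. 1 \<le> i \<Longrightarrow> i < plen lam \<Longrightarrow> lam i \<le> n \<Longrightarrow> lam (i + 1) < lam i"
    using less.prems by (auto simp: bounded_parts_def)
  define m where "m = plen lam"
  have supp: "lam r \<noteq> 0 \<longleftrightarrow> 1 \<le> r \<and> r \<le> m" for r
    using partition_support[OF P] by (auto simp: m_def set_eq_iff)
  have le2n: "lam r \<le> 2 * n" for r
  proof (cases "1 \<le> r")
    case True
    then show ?thesis using partition_antimono[OF P, of 1 r] l1 by simp
  next
    case False
    then show ?thesis using supp[of r] by simp
  qed
  show ?case
  proof (cases "m = 0")
    case True
    let ?e = "\<lambda>_. 0 :: nat"
    have "x - 2 * int n \<in> beads ?e" if "x \<in> beads ?e" for x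
    proof -
      obtain r where "1 \<le> r" "x = bead ?e r" using \<open>x \<in> beads ?e\<close> by (rule beadsE)
      then have "x - 2 * int n = bead ?e (r + 2 * n)" by (simp add: bead_def)
      then show ?thesis using bead_in_beads[of "r + 2 * n" ?e] \<open>1 \<le> r\<close> by simp
    qed
    then have "?e \<in> sym_cores n"
      by (auto simp: sym_cores_iff[OF n] is_partition_def is_symmetric_def dg_def)
    moreover have "dg ?e = {}" by (auto simp: dg_def)
    then have "pmap n ?e r = lam r" for r using supp[of r] True by (auto simp: pmap_def)
    then have "pmap n ?e = lam" by (rule ext)
    ultimately show ?thesis by blast
  next
    case False
    then have m: "1 \<le> m" by simp
    define mu where "mu = lam(m := lam m - 1)"
    have mu_pos: "mu r \<noteq> 0 \<longleftrightarrow> 1 \<le> r \<and> r \<le> (if lam m = 1 then m - 1 else m)" for r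
      using supp[of r] supp[of m] m by (cases "r = m") (auto simp: mu_def)
    then have mu_supp: "{r. mu r \<noteq> 0} = {1..if lam m = 1 then m - 1 else m}"
      by (simp add: atLeastAtMost_def atLeast_def atMost_def Int_def)
    have fin: "finite {r. mu r \<noteq> 0}" unfolding mu_supp by simp
    have mu_le: "mu (i + 1) \<le> mu i" if "1 \<le> i" for i
      using partition_antimono[OF P that, of "i + 1"] supp[of "i + 1"] by (auto simp: mu_def)
    have "mu 0 = 0" using supp[of 0] m by (simp add: mu_def)
    then have muP: "is_partition mu" using fin mu_le unfolding is_partition_def by blast
    have mu_plen: "plen mu = (if lam m = 1 then m - 1 else m)" unfolding plen_def mu_supp by simp
    have "mu (i + 1) < mu i" if "1 \<le> i" "i < plen mu" "mu i \<le> n" for i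
    proof -
      have "i < m" using that mu_plen by (auto split: if_splits)
      then show ?thesis using strict[of i] that by (auto simp: mu_def m_def)
    qed
    moreover have "mu 1 \<le> 2 * n" using l1 by (auto simp: mu_def)
    ultimately have mu_b: "mu \<in> bounded_parts n" using muP by (simp add: bounded_parts_def)
    have "(\<Sum>r\<in>{1..plen mu}. mu r) \<le> (\<Sum>r\<in>{1..m}. mu r)"
      by (rule sum_mono2) (auto simp: mu_plen)
    also have "\<dots> < (\<Sum>r\<in>{1..m}. lam r)"
      by (rule sum_strict_mono_ex1) (use m supp[of m] in \<open>auto simp: mu_def intro!: bexI[of _ m]\<close>)
    finally obtain kap where kap: "kap \<in> sym_cores n" "pmap n kap = mu"
      using less.hyps[OF _ mu_b] by (auto simp: m_def)
    interpret sym_partition kap using kap(1) by (rule sym_cores_sym_partition)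
    interpret core_set n "beads kap" using n kap(1) by (rule sym_cores_core_set)
    have pm: "mu r = (if 1 \<le> r \<and> 0 \<le> bead kap r then wt n (beads kap) (bead kap r) else 0)" for r
      using pmap_wt[OF n kap(1), of r] kap(2) by simp
    have nonneg: "0 \<le> bead kap r \<longleftrightarrow> mu r \<noteq> 0" if "1 \<le> r" for r
      using pm[of r] that by (simp add: wt_def)
    \<comment> \<open>No residue is given; it is chosen to suit the target of the bead of row
      \<open>m\<close>.\<close>
    have "\<exists>i. bead kap m \<in> movable n i (beads kap) \<and> - 1 \<le> bead kap m \<and>
      (\<forall>x\<in>movable n i (beads kap). - 1 \<le> x \<longrightarrow> bead kap m \<le> x)"
    proof (cases "lam m = 1")
      case True
      \<comment> \<open>A bead at 0 would have weight 1, giving \<open>lam\<close> a second part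
        equal to 1 against strictness. So \<open>- 1\<close> is a bead, and it belongs to row
        \<open>m\<close>, the first row with entry 0; its target has colour 0.\<close>
      have "0 \<notin> beads kap"
      proof
        assume "0 \<in> beads kap"
        then obtain r where r: "1 \<le> r" "0 = bead kap r" by (rule beadsE)
        then have "mu r = 1" using pm[of r] n by (simp add: wt_def)
        then have "r < m" "lam r = 1" using mu_pos[of r] True m by (auto simp: mu_def split: if_splits)
        then have "lam (r + 1) < 1" using strict[of r] r n by (simp add: m_def)
        then show False using supp[of "r + 1"] \<open>r < m\<close> by simp
      qed
      then have "- 1 \<in> beads kap" using reflect[of 0] by simp
      then obtain r where r: "1 \<le> r" "- 1 = bead kap r" by (rule beadsE)
      have "bead kap m < 0" using nonneg[OF m] True by (simp add: mu_def)
      moreover have "m \<le> r"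
      proof (rule ccontr)
        assume "\<not> m \<le> r"
        then have "mu r \<noteq> 0" using supp[of r] r by (simp add: mu_def)
        then show False using nonneg[OF r(1)] r(2) by simp
      qed
      ultimately have "bead kap m = - 1"
        using bead_less[OF part m, of r] r by (cases "r = m") auto
      then show ?thesis using \<open>0 \<notin> beads kap\<close> \<open>- 1 \<in> beads kap\<close>
        by (intro exI[of _ 0]) (simp add: movable_def colour_def)
    next
      case l2: False
      then have l2: "2 \<le> lam m" using supp[of m] m by auto
      define y where "y = bead kap m"
      have y: "0 \<le> y" "y \<in> beads kap" using nonneg[OF m] l2 bead_in_beads[OF m] by (auto simp: y_def mu_def)
      have wy: "wt n (beads kap) y = lam m - 1" using pm[of m] m y by (simp add: y_def mu_def)
      have low: "y \<le> x" if "x \<in> beads kap" "0 \<le> x" for x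
      proof -
        obtain r where r: "1 \<le> r" "x = bead kap r" using \<open>x \<in> beads kap\<close> by (rule beadsE)
        then have "mu r \<noteq> 0" using nonneg[OF r(1)] that by simp
        then have "r \<le> m" using supp[of r] by (auto simp: mu_def split: if_splits)
        then show ?thesis using bead_less[OF part r(1), of m] r(2) by (cases "r = m") (auto simp: y_def)
      qed
      \<comment> \<open>If \<open>y + 1\<close> were a bead, then its row would have a part equal to
        \<open>lam m\<close> and at most \<open>n\<close>, or the reflection would fail at
        \<open>y = n - 1\<close>, or its part would be smaller than \<open>lam m\<close>.\<close>
      have y1: "y + 1 \<notin> beads kap"
      proof
        assume y1: "y + 1 \<in> beads kap"
        then obtain r where r: "1 \<le> r" "y + 1 = bead kap r" by (rule beadsE)
        then have "r < m" using bead_less_iff[OF part r(1) m] by (simp add: y_def)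
        then have wr: "lam r = wt n (beads kap) (y + 1)" using pm[of r] r y by (simp add: mu_def)
        have ge: "lam m \<le> lam r" using partition_antimono[OF P r(1), of m] \<open>r < m\<close> by simp
        consider "y + 1 < int n" | "y + 1 = int n" | "int n \<le> y" by linarith
        then show False
        proof cases
          case 1
          then have lr: "lam r = lam m" "lam r \<le> n"
            using wr wy y l2 by (auto simp: wt_def nat_add_distrib)
          then have "lam (r + 1) < lam r" using strict[of r] r \<open>r < m\<close> by (simp add: m_def)
          then show False using lr partition_antimono[OF P, of "r + 1" m] \<open>r < m\<close> by simp
        next
          case 2
          then have "y + 1 - 2 * int n = - 1 - y" by simp
          then have "- 1 - y \<in> beads kap" using down[OF y1] by (simp only:)
          then show False using reflect[of y] y by simp
        next
          case 3
          then show False using wr wy ge gaps_bead[OF y1] l2 by (simp add: wt_def)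
        qed
      qed
      define i where "i = nat ((y + 1) mod (2 * int n))"
      have "int i = (y + 1) mod (2 * int n)" using n by (simp add: i_def)
      then have col: "colour n i (y + 1)" by (simp add: colour_def)
      have "y \<le> x" if x: "x \<in> movable n i (beads kap)" "- 1 \<le> x" for x
      \<comment> \<open>The bound \<open>lam 1 \<le> 2n\<close> enters here: were \<open>- 1\<close>
        movable, the lowest nonnegative bead would be \<open>y = 2n - 1\<close>, with only gaps from
        0 to \<open>y - 1\<close>. Its weight \<open>2n\<close> would make \<open>lam m\<close>
        equal to \<open>2n + 1\<close>.\<close>
      proof (cases "x = - 1")
        case True
        have "colour n i 0" using x True by (simp add: movable_def)
        then have dv: "2 * int n dvd y + 1" using colour_cong[OF col, of 0] by simp
        have "\<not> 2 * int n \<le> y"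
          using down[OF y(2)] low[of "y - 2 * int n"] n by auto
        then have y2: "y + 1 = 2 * int n" using zdvd_imp_le[OF dv] y(1) by simp
        have "y - 2 * int n < x \<and> x \<le> y \<and> x \<notin> beads kap \<longleftrightarrow> x \<in> {0..<y}" for x
          using low[of x] y y2 by (cases "x = y") auto
        then have "{x. y - 2 * int n < x \<and> x \<le> y \<and> x \<notin> beads kap} = {0..<y}" by blast
        then have "gaps n (beads kap) y = nat y" by (simp add: gaps_def)
        then have "lam m - 1 = 2 * n" using wy y2 n by (auto simp: wt_def)
        then show ?thesis using le2n[of m] n by simp
      next
        case False
        then show ?thesis using low[of x] x by (simp add: movable_def)
      qed
      then show ?thesis using y y1 col by (auto simp: y_def[symmetric] movable_def)
    qed
    then obtain i where "bead kap m \<in> movable n i (beads kap)" "- 1 \<le> bead kap m"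
      "\<And>x. x \<in> movable n i (beads kap) \<Longrightarrow> - 1 \<le> x \<Longrightarrow> bead kap m \<le> x" by blast
    from pmap_raised[OF n kap(1) m this] have "pmap n (raised n i kap) = lam"
      using kap(2) supp[of m] m by (auto simp: eps_def mu_def fun_eq_iff)
    then show ?thesis using raised_sym_core[OF n kap(1)] by blast
  qed
qed

lemma pinv_pmap:
  assumes "1 \<le> n" "kap \<in> sym_cores n"
  shows "pinv n (pmap n kap) = kap"
  unfolding pinv_def using pmap_inj[OF assms(1)] assms(2) by (rule inv_into_f_f)

lemma pinv_bounded:
  assumes "1 \<le> n" "lam \<in> bounded_parts n"
  shows "pinv n lam \<in> sym_cores n" "pmap n (pinv n lam) = lam"
proof -
  have "lam \<in> pmap n ` sym_cores n" using pmap_surj[OF assms] by blast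
  then show "pinv n lam \<in> sym_cores n" "pmap n (pinv n lam) = lam"
    unfolding pinv_def by (rule inv_into_into, rule f_inv_into_f)
qed

section \<open>The generators in terms of bounded partitions\<close>

lemma residue_swap:
  "residue n (c, r) = int i mod (2 * int n) \<longleftrightarrow> residue n (r, c) = (2 * int n - int i) mod (2 * int n)"
proof -
  have "int c - int r - (2 * int n - int i) = - (int r - int c - int i) - 2 * int n" by simp
  then have "2 * int n dvd int c - int r - (2 * int n - int i) \<longleftrightarrow>
      2 * int n dvd - (int r - int c - int i)"
    by (simp only: dvd_diff_left_iff dvd_diff_right_iff dvd_refl)
  also have "\<dots> \<longleftrightarrow> 2 * int n dvd int r - int c - int i"
    by (rule dvd_minus_iff)
  finally show ?thesis by (simp only: residue_def content.simps mod_eq_dvd_iff)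
qed

context sym_partition
begin

text \<open>\<open>s_act\<close> tests for residue \<open>i\<close> alone but moves both classes.
  Transposing a corner negates its content, so one class has an addable corner exactly when the
  other does.\<close>

lemma ex_addable_residue:
  "(\<exists>b. addable kap b \<and> residue n b = int i mod (2 * int n)) \<longleftrightarrow> movable n i (beads kap) \<noteq> {}"
proof -
  have "(\<exists>b. addable kap b \<and> residue n b = int i mod (2 * int n)) \<longleftrightarrow>
      (\<exists>r c. addable kap (r, c) \<and> residue_pm n i (r, c))"
    using addable_swap residue_swap unfolding residue_pm_def by (metis surj_pair)
  also have "\<dots> \<longleftrightarrow> (\<exists>r\<ge>1. bead kap r \<in> movable n i (beads kap))"
    by (simp add: addable_pm_iff[OF part])
  also have "\<dots> \<longleftrightarrow> movable n i (beads kap) \<noteq> {}"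
    by (auto simp: movable_def beads_def)
  finally show ?thesis .
qed

lemma ex_removable_residue:
  "(\<exists>b. removable kap b \<and> residue n b = int i mod (2 * int n)) \<longleftrightarrow> droppable n i (beads kap) \<noteq> {}"
proof -
  have "(\<exists>b. removable kap b \<and> residue n b = int i mod (2 * int n)) \<longleftrightarrow>
      (\<exists>r c. removable kap (r, c) \<and> residue_pm n i (r, c))"
    using removable_swap residue_swap unfolding residue_pm_def by (metis surj_pair)
  also have "\<dots> \<longleftrightarrow> (\<exists>r\<ge>1. bead kap r \<in> droppable n i (beads kap))"
    by (simp add: removable_pm_iff[OF part])
  also have "\<dots> \<longleftrightarrow> droppable n i (beads kap) \<noteq> {}"
    by (auto simp: droppable_def beads_def)
  finally show ?thesis .
qed

lemma s_act_eq:
  "s_act n i kap =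
    (if movable n i (beads kap) \<noteq> {} then raised n i kap
     else if droppable n i (beads kap) \<noteq> {} then lowered n i kap else kap)"
  unfolding s_act_def ex_addable_residue ex_removable_residue
    dg_raised[OF part, symmetric] dg_lowered[OF part, symmetric]
    part_of_dg_dg[OF raised_partition[OF part]] part_of_dg_dg[OF lowered_partition[OF part]] ..

end

text \<open>A removed corner becomes addable at the same place, with the same content; this turns
  \<open>r\<close> for \<open>kap\<close> into \<open>a\<close> for the lowered core.\<close>

lemma lowered_rows:
  assumes part: "is_partition kap" and none: "movable n i (beads kap) = {}"
  shows "addable_rows n i (lowered n i kap) = removable_rows n i kap"
proof -
  have "bead (lowered n i kap) r \<in> movable n i (beads (lowered n i kap)) \<and> - 1 \<le> bead (lowered n i kap) r
      \<longleftrightarrow> bead kap r \<in> droppable n i (beads kap) \<and> 0 \<le> bead kap r" if r: "1 \<le> r" for r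
  proof -
    have "bead kap r + 1 \<notin> droppable n i (beads kap)"
      using bead_in_beads[OF r, of kap] by (simp add: droppable_def)
    then show ?thesis by (auto simp: movable_lowered[OF assms] bead_lowered[OF part r])
  qed
  then show ?thesis
    by (auto simp: addable_rows_eq[OF lowered_partition[OF part]] removable_rows_eq[OF part])
qed

theorem theorem4p4:
  fixes n i :: nat and lam kap :: "nat \<Rightarrow> nat" and a r :: nat
  assumes "n \<ge> 2" and "i \<in> {0..n}" and "lam \<in> bounded_parts n"
    and "kap = pinv n lam"
    and "a = Max (addable_rows n i kap)"
    and "r = Max (removable_rows n i kap)"
  shows
    "(dg kap \<subset> dg (s_act n i kap) \<longrightarrow>
        finite (addable_rows n i kap) \<and> addable_rows n i kap \<noteq> {} \<and>
        (\<lambda>j. lam j + eps a j) \<in> bounded_parts n \<and>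
        s_act n i kap = pinv n (\<lambda>j. lam j + eps a j)) \<and>
     (dg (s_act n i kap) \<subset> dg kap \<longrightarrow>
        finite (removable_rows n i kap) \<and> removable_rows n i kap \<noteq> {} \<and>
        1 \<le> lam r \<and> (\<lambda>j. lam j - eps r j) \<in> bounded_parts n \<and>
        s_act n i kap = pinv n (\<lambda>j. lam j - eps r j)) \<and>
     (\<not> dg kap \<subset> dg (s_act n i kap) \<and> \<not> dg (s_act n i kap) \<subset> dg kap \<longrightarrow>
        s_act n i kap = kap)"
proof -
  have n: "1 \<le> n" using assms(1) by simp
  have kap: "kap \<in> sym_cores n" and lam: "pmap n kap = lam"
    using pinv_bounded[OF n assms(3)] assms(4) by simp_all
  interpret sym_partition kap using kap by (rule sym_cores_sym_partition)
  let ?M = "movable n i (beads kap)" and ?R = "droppable n i (beads kap)"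
  have up: "dg kap \<subset> dg (raised n i kap)" if "?M \<noteq> {}"
  proof -
    from that obtain x where x: "x \<in> ?M" by blast
    then have "x \<in> beads kap" by (simp add: movable_def)
    then obtain s where "1 \<le> s" "bead kap s \<in> ?M" using x by (auto elim: beadsE)
    then have "addable kap (s, kap s + 1)" "residue_pm n i (s, kap s + 1)"
      using addable_pm_iff[OF part] by blast+
    then show ?thesis unfolding dg_raised[OF part] by (auto simp: addable_def)
  qed
  have low: "dg (lowered n i kap) \<subset> dg kap" if "?R \<noteq> {}"
  proof -
    from that obtain x where x: "x \<in> ?R" by blast
    then have "x \<in> beads kap" by (simp add: droppable_def)
    then obtain s where "1 \<le> s" "bead kap s \<in> ?R" using x by (auto elim: beadsE)
    then have "removable kap (s, kap s)" "residue_pm n i (s, kap s)"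
      using removable_pm_iff[OF part] by blast+
    then show ?thesis unfolding dg_lowered[OF part] by (auto simp: removable_def)
  qed
  \<comment> \<open>By \<open>up\<close> and \<open>low\<close> every nontrivial move changes the
    diagram strictly, so these cases match the three inclusion hypotheses.\<close>
  consider (add) "?M \<noteq> {}" | (rem) "?M = {}" "?R \<noteq> {}" | (none) "?M = {}" "?R = {}" by blast
  then show ?thesis
  proof cases
    case add
    have act: "s_act n i kap = raised n i kap" using add by (simp add: s_act_eq)
    note core = raised_sym_core[OF n kap, of i]
    have "pmap n (raised n i kap) = (\<lambda>j. lam j + eps a j)"
      using pmap_raised_Max(2)[OF n kap add] lam assms(5) by simp
    then have "(\<lambda>j. lam j + eps a j) \<in> bounded_parts n" "raised n i kap = pinv n (\<lambda>j. lam j + eps a j)"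
      using pmap_bounded[OF n core] pinv_pmap[OF n core] by simp_all
    then show ?thesis
      using act up[OF add] addable_rows_finite[OF part] pmap_raised_Max(1)[OF n kap add] by auto
  next
    case rem
    have act: "s_act n i kap = lowered n i kap" using rem by (simp add: s_act_eq)
    let ?k = "lowered n i kap"
    have core: "?k \<in> sym_cores n" using n kap by (rule lowered_sym_core)
    have M: "movable n i (beads ?k) \<noteq> {}"
    proof -
      obtain x where "x \<in> ?R" using rem by blast
      then have "x - 1 \<in> movable n i (beads ?k)" by (simp add: movable_lowered[OF part rem(1)])
      then show ?thesis by blast
    qed
    note rows = lowered_rows[OF part rem(1)]
    \<comment> \<open>The result for addition is applied to the lowered core, whose raising is
      \<open>kap\<close>; this also shows \<open>1 \<le> lam r\<close>, so the later subtraction is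
      a true one.\<close>
    have "lam = (\<lambda>j. pmap n ?k j + eps r j)"
      using pmap_raised_Max(2)[OF n core M] lam assms(6) by (simp add: raised_lowered[OF part rem(1)] rows)
    then have eq: "lam j = pmap n ?k j + eps r j" for j by (rule fun_cong)
    then have "(\<lambda>j. lam j - eps r j) = pmap n ?k" by simp
    then have "(\<lambda>j. lam j - eps r j) \<in> bounded_parts n" "?k = pinv n (\<lambda>j. lam j - eps r j)"
      using pmap_bounded[OF n core] pinv_pmap[OF n core] by simp_all
    moreover have "1 \<le> lam r" using eq[of r] by (simp add: eps_def)
    moreover have "finite (removable_rows n i kap)" "removable_rows n i kap \<noteq> {}"
      using addable_rows_finite[OF lowered_partition[OF part], of n i n i] pmap_raised_Max(1)[OF n core M]
      by (simp_all add: rows)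
    ultimately show ?thesis using act low[OF rem(2)] by auto
  next
    case none
    then have "s_act n i kap = kap" by (simp add: s_act_eq)
    then show ?thesis by simp
  qed
qed

end
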